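(* For any $3$-branch piecewise linear expanding map $T: X=\bigcup_{i=1}^3 X_i\to[0,1]$, the number of its Lyapunov inflections is less than or equal to $2$.
   Context: An $n$-branch piecewise linear expanding map is a map $T: X=\bigcup_{i=1}^n X_i\to[0,1]$, where $X_1,\dots,X_n\subset[0,1]$ are closed intervals with pairwise disjoint interiors, each $T|_{X_i}$ is affine and maps $X_i$ onto $[0,1]$, and $|T'|=x_i:=|X_i|^{-1}>1$ on $X_i$ (the numbers $x_i$ are called the slopes; ambiguities at common endpoints are irrelevant). Indices are arranged so that $1<x_1\le x_2\le\cdots\le x_n$; slopes may coincide. The repeller is $\Lambda=\bigcap_{k\ge 0}T^{-k}(X)$. The Lyapunov exponent at $x\in\Lambda$ is $\lambda(x)=\lim_{m\to\infty}\frac1m\log|(T^m)'(x)|$ when the limit exists. The Lyapunov spectrum is $L(\alpha)=\dim_H\{x\in\Lambda:\lambda(x)=\alpha\}$ (Hausdorff dimension), defined for those $\alpha$ with nonempty level set; its domain is $[\log x_1,\log x_n]$. A Lyapunov inflection of $T$ is a point $\alpha\in(\log x_1,\log x_n)$ with $L''(\alpha)=0$. If the slopes are not all equal, put $F(t)=\sum_{i=1}^n x_i^t$. Then $\alpha(t)=F'(t)/F(t)$ is an increasing bijection from $\mathbb{R}$ onto $(\log x_1,\log x_n)$, and $L(\alpha(t))=\frac{F(t)\log F(t)}{F'(t)}-t$. *)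

theory Defs
  imports "HOL-Analysis.Analysis"
begin

text \<open>
  Hausdorff measure and dimension. Unbounded sets, for which the library's \<^const>\<open>diameter\<close>
  is meaningless, are not allowed in covers. The gauge of exponent 0 is treated separately because
  \<open>0 powr 0 = 0\<close>, whereas every nonempty set has gauge 1 for \<open>s = 0\<close>. The empty set has gauge 0,
  so finite covers are included.
\<close>

definition hausdorff_gauge :: "real \<Rightarrow> 'a::metric_space set \<Rightarrow> real" where
  "hausdorff_gauge s U =
     (if U = {} then 0 else if s = 0 then 1 else diameter U powr s)"

definition hausdorff_premeasure :: "real \<Rightarrow> real \<Rightarrow> 'a::metric_space set \<Rightarrow> ennreal" where
  "hausdorff_premeasure s \<delta> A =
     (INF U \<in> {U :: nat \<Rightarrow> 'a set. A \<subseteq> (\<Union>i. U i) \<and> (\<forall>i. bounded (U i) \<and> diameter (U i) \<le> \<delta>)}.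
        (\<Sum>i. ennreal (hausdorff_gauge s (U i))))"

definition hausdorff_measure :: "real \<Rightarrow> 'a::metric_space set \<Rightarrow> ennreal" where
  "hausdorff_measure s A = (SUP \<delta> \<in> {0<..}. hausdorff_premeasure s \<delta> A)"

definition hausdorff_dim :: "'a::metric_space set \<Rightarrow> ennreal" where
  "hausdorff_dim A = (INF s \<in> {s. 0 \<le> s \<and> hausdorff_measure s A = 0}. ennreal s)"

definition slope :: "(nat \<Rightarrow> real set) \<Rightarrow> nat \<Rightarrow> real" where
  "slope X i = inverse (measure lborel (X i))"

definition branch_union :: "nat \<Rightarrow> (nat \<Rightarrow> real set) \<Rightarrow> real set" where
  "branch_union n X = (\<Union>i\<in>{1..n}. X i)"

text \<open>
  \<open>T\<close> is a total function whose values outside the union of the branches are irrelevant.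
  At a common endpoint of two branches it may take the value of either of the two affine maps
  \<open>g i\<close>; at every other point of \<open>X i\<close> the last clause forces \<open>T x = g i x\<close>. The condition
  \<open>1 < slope X i\<close> makes each \<open>X i\<close> nondegenerate, and surjectivity of \<open>g i\<close> from \<open>X i\<close> onto
  \<open>[0,1]\<close> makes \<open>slope X i\<close> the absolute value of its derivative.
\<close>

definition pl_expanding_map ::
    "nat \<Rightarrow> (nat \<Rightarrow> real set) \<Rightarrow> (real \<Rightarrow> real) \<Rightarrow> bool" where
  "pl_expanding_map n X T \<longleftrightarrow>
     (\<forall>i\<in>{1..n}. (\<exists>a b. X i = {a..b}) \<and> X i \<subseteq> {0..1} \<and> 1 < slope X i) \<and>
     disjoint_family_on (\<lambda>i. interior (X i)) {1..n} \<and>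
     mono_on {1..n} (slope X) \<and>
     (\<exists>g :: nat \<Rightarrow> real \<Rightarrow> real.
        (\<forall>i\<in>{1..n}. (\<exists>c d. \<forall>x. g i x = c * x + d) \<and> g i ` X i = {0..1}) \<and>
        (\<forall>x\<in>branch_union n X. \<exists>i\<in>{1..n}. x \<in> X i \<and> T x = g i x))"

definition repeller :: "nat \<Rightarrow> (nat \<Rightarrow> real set) \<Rightarrow> (real \<Rightarrow> real) \<Rightarrow> real set" where
  "repeller n X T = (\<Inter>k. (T ^^ k) -` branch_union n X)"

text \<open>The set on which the \<open>m\<close>-th iterate of \<open>T\<close>, as a partial map, is defined.\<close>

definition iterate_dom ::
    "nat \<Rightarrow> (nat \<Rightarrow> real set) \<Rightarrow> (real \<Rightarrow> real) \<Rightarrow> nat \<Rightarrow> real set" where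
  "iterate_dom n X T m = (\<Inter>k\<in>{..<m}. (T ^^ k) -` branch_union n X)"

text \<open>
  The Lyapunov exponent at \<open>x\<close> exists and equals \<open>\<alpha>\<close>. Derivatives are taken within the domain of
  the iterate, hence one-sided where \<open>x\<close> is a boundary point of that domain. At the (countably
  many) points whose orbit meets a common endpoint of two branches the derivative does not exist,
  and these points are in no level set.
\<close>

definition has_lyapunov_exponent ::
    "nat \<Rightarrow> (nat \<Rightarrow> real set) \<Rightarrow> (real \<Rightarrow> real) \<Rightarrow> real \<Rightarrow> real \<Rightarrow> bool" where
  "has_lyapunov_exponent n X T x \<alpha> \<longleftrightarrow>
     (\<exists>D :: nat \<Rightarrow> real.
        (\<forall>m. ((T ^^ m) has_real_derivative D m) (at x within iterate_dom n X T m)) \<and>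
        (\<lambda>m. 1 / real m * ln \<bar>D m\<bar>) \<longlonglongrightarrow> \<alpha>)"

definition lyapunov_spectrum ::
    "nat \<Rightarrow> (nat \<Rightarrow> real set) \<Rightarrow> (real \<Rightarrow> real) \<Rightarrow> real \<Rightarrow> real" where
  "lyapunov_spectrum n X T \<alpha> =
     enn2real (hausdorff_dim {x \<in> repeller n X T. has_lyapunov_exponent n X T x \<alpha>})"

definition lyapunov_inflections ::
    "nat \<Rightarrow> (nat \<Rightarrow> real set) \<Rightarrow> (real \<Rightarrow> real) \<Rightarrow> real set" where
  "lyapunov_inflections n X T =
     {\<alpha> \<in> {ln (slope X 1)<..<ln (slope X n)}. deriv (deriv (lyapunov_spectrum n X T)) \<alpha> = 0}"

end

theory Submission
  imports Defs "HOL-Probability.Probability"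
begin

text \<open>
  Put \<open>a i = ln (slope X i)\<close>, \<open>P t = ln (\<Sum>i. exp (t * a i))\<close> and \<open>\<alpha> = P' t\<close>. The spectrum is
  \<open>L \<alpha> = P t / \<alpha> - t\<close>: covering the level set by the cylinders of words whose Birkhoff average is
  close to \<open>\<alpha>\<close> bounds the dimension from above, and the Bernoulli measure with weights
  \<open>exp (t * a i - P t)\<close>, under which almost every orbit has exponent \<open>\<alpha>\<close>, bounds it from below.

  Differentiating, \<open>L'' \<alpha> = - h t / \<alpha>\<^sup>3\<close> with \<open>h = P'\<^sup>2 / P'' - 2 * P\<close>, and
  \<open>h' = - P'\<^sup>2 * P''' / P''\<^sup>2\<close>. For three branches \<open>P'''\<close> is a positive function times a
  strictly decreasing one, so it has at most one zero, and by Rolle's theorem \<open>h\<close> has at most two.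
\<close>

section \<open>Inflections of the explicit spectrum\<close>

text \<open>What three branches provide: \<open>K3\<close> is a cubic form in three exponentials.
  After division by their product the mixed term is constant and every other term is an exponential
  of a difference of exponents, so one monotonicity argument controls the zeros. Slopes may
  coincide, hence strict inequalities have to come from \<open>a < c\<close>. Moreover
  \<open>deriv\<close> is unspecified where no derivative exists, so the closed form of the spectrum
  is needed on the whole open interval before anything is differentiated. For the dimension, values
  of Hausdorff measures are never computed: it suffices that the level set is null for every
  exponent above the claimed value and not null for every positive exponent below it. The branches
  do not determine \<open>T\<close> at a common endpoint; cylinders are therefore built from the
  affine maps \<open>g i\<close>, and orbits that meet an endpoint form a countable set, null for
  every positive exponent.\<close>

lemma at_most_two_zeros:
  fixes h h' :: "real \<Rightarrow> real"
  assumes h: "\<And>t. (h has_real_derivative h' t) (at t)"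
    and h': "\<And>s t. h' s = 0 \<Longrightarrow> h' t = 0 \<Longrightarrow> s = t"
  shows "finite {t. h t = 0} \<and> card {t. h t = 0} \<le> 2"
proof (rule ccontr)
  assume neg: "\<not> ?thesis"
  have "\<exists>B\<subseteq>{t. h t = 0}. card B = 3"
  proof (cases "finite {t. h t = 0}")
    case True
    with neg show ?thesis
      by (metis obtain_subset_with_card_n not_less_eq_eq numeral_2_eq_2 numeral_3_eq_3)
  next
    case False
    then show ?thesis by (metis infinite_arbitrarily_large)
  qed
  then obtain B where B: "B \<subseteq> {t. h t = 0}" "card B = 3" by blast
  define xs where "xs = sorted_list_of_set B"
  have fB: "finite B" using B(2) by (metis card.infinite zero_neq_numeral)
  have len: "length xs = 3" and ss: "sorted_wrt (<) xs" and set: "set xs = B"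
    unfolding xs_def using B(2) fB by auto
  define x y z where "x = xs ! 0" and "y = xs ! 1" and "z = xs ! 2"
  have "x < y" "y < z"
    using ss len unfolding x_def y_def z_def by (auto simp: sorted_wrt_iff_nth_less)
  have "x \<in> B" "y \<in> B" "z \<in> B"
    using nth_mem[of _ xs] set len unfolding x_def y_def z_def by auto
  then have zero: "h x = 0" "h y = 0" "h z = 0" using B(1) by auto
  have cont: "continuous_on S h" for S
    using h by (meson DERIV_isCont continuous_at_imp_continuous_on)
  have rolle: "\<exists>u. x < u \<and> u < y \<and> h' u = 0" if "x < y" "h x = 0" "h y = 0" for x y
    using Rolle[of x y h] that cont h by (metis DERIV_unique real_differentiable_def)
  obtain u where u: "x < u" "u < y" "h' u = 0"
    using rolle[OF \<open>x < y\<close>] zero by auto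
  obtain v where v: "y < v" "v < z" "h' v = 0"
    using rolle[OF \<open>y < z\<close>] zero by auto
  show False using h'[of u v] u v by auto
qed

text \<open>For large \<open>t\<close> the term with exponent \<open>c\<close> dominates; an
  explicit \<open>t\<close> replaces a limit. Applied to the exponents and to their negatives, this
  supplies the two endpoints for the intermediate value theorem in
  \<open>mean_range\<close>.\<close>

lemma weighted_exp_nonneg:
  fixes a b c \<alpha> :: real
  assumes "a \<le> b" "b \<le> c" "a < \<alpha>" "\<alpha> < c"
  obtains t where "0 \<le> (a - \<alpha>) * exp (a * t) + (b - \<alpha>) * exp (b * t) + (c - \<alpha>) * exp (c * t)"
proof -
  \<comment> \<open>\<open>m\<close> is the largest of \<open>a\<close> and \<open>b\<close> lying
    below \<open>\<alpha>\<close>, so negative terms grow at most like exp (m * t). \<open>t\<close>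
    solves (c - \<alpha>) * exp (c * t) = 2 * (c - a) * exp (m * t); the factor 2 pays for the two
    other terms.\<close>
  define m where "m = (if b < \<alpha> then b else a)"
  define t where "t = ln (2 * (c - a) / (c - \<alpha>)) / (c - m)"
  have m: "m < c" "a \<le> m" using assms unfolding m_def by auto
  have "1 \<le> 2 * (c - a) / (c - \<alpha>)" using assms by (simp add: field_simps)
  then have t: "0 \<le> t" "exp ((c - m) * t) = 2 * (c - a) / (c - \<alpha>)" unfolding t_def using m by auto
  have "exp (c * t) = exp (m * t) * exp ((c - m) * t)"
    by (simp add: algebra_simps flip: exp_add)
  then have ct: "(c - \<alpha>) * exp (c * t) = 2 * (c - a) * exp (m * t)"
    unfolding t(2) using assms by (simp add: field_simps)
  have a: "(\<alpha> - a) * exp (a * t) \<le> (c - a) * exp (m * t)"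
    using assms m t by (intro mult_mono) (auto intro: mult_right_mono)
  have b: "(\<alpha> - b) * exp (b * t) \<le> (c - a) * exp (m * t)"
  proof (cases "b < \<alpha>")
    case True
    then show ?thesis using assms unfolding m_def by (auto intro: mult_right_mono)
  next
    case False
    then have "(\<alpha> - b) * exp (b * t) \<le> 0" by (simp add: mult_le_0_iff)
    also have "0 \<le> (c - a) * exp (m * t)" using assms by simp
    finally show ?thesis .
  qed
  show ?thesis by (rule that[of t]) (use a b ct in \<open>simp add: algebra_simps\<close>)
qed

section \<open>Calculus of the pressure function for three exponents\<close>

locale three_exponents =
  fixes a b c :: real
  assumes ab: "a \<le> b" and bc: "b \<le> c" and ac: "a < c" and a0: "0 < a"
begin

definition F :: "nat \<Rightarrow> real \<Rightarrow> real" where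
  "F k t = a ^ k * exp (a * t) + b ^ k * exp (b * t) + c ^ k * exp (c * t)"

lemma F_pos: "0 < F k t"
  unfolding F_def using ab bc a0 by (intro add_pos_pos mult_pos_pos zero_less_power) auto

lemma F_deriv [derivative_intros]: "(F k has_real_derivative F (Suc k) t) (at t)"
  unfolding F_def by (rule derivative_eq_intros refl | simp add: algebra_simps)+

text \<open>\<open>V\<close> and \<open>K3\<close> are the second and third derivatives of \<open>ln \<circ> F 0\<close>, cleared of denominators.\<close>

definition V :: "real \<Rightarrow> real" where "V t = F 2 t * F 0 t - (F 1 t)\<^sup>2"

text \<open>A variance is a weighted sum of squared differences over pairs; the pair
  \<open>a\<close>, \<open>c\<close> keeps it positive when \<open>b\<close> coincides with one of
  them.\<close>

lemma V_pos: "0 < V t"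
proof -
  define u v w where "u = exp (a * t)" "v = exp (b * t)" "w = exp (c * t)"
  have "V t = u * v * (b - a)\<^sup>2 + v * w * (c - b)\<^sup>2 + u * w * (c - a)\<^sup>2"
    unfolding V_def F_def u_v_w_def[symmetric] by (simp add: power2_eq_square algebra_simps)
  moreover have "u * w * (c - a)\<^sup>2 > 0" using ac by (simp add: u_v_w_def)
  ultimately show ?thesis by (simp add: u_v_w_def add_nonneg_pos)
qed

definition K3 :: "real \<Rightarrow> real" where
  "K3 t = F 3 t * (F 0 t)\<^sup>2 - 3 * F 0 t * F 1 t * F 2 t + 2 * (F 1 t)^3"

text \<open>\<open>K3\<close> divided by the product of the three exponentials u, v, w. Each line
  with a bracket comes from one pair of exponents, as (b - a)^3 * (u - v) * u * v does; the last
  line is the coefficient of u * v * w.\<close>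

definition M :: "real \<Rightarrow> real" where
  "M t = (b - a)^3 * (exp (-(c - a) * t) - exp (-(c - b) * t))
       + (c - b)^3 * (exp ((b - a) * t) - exp ((c - a) * t))
       + (c - a)^3 * (exp (-(b - a) * t) - exp ((c - b) * t))
       + ((c - a) + (c - b)) * ((c - a) + (b - a)) * ((c - b) - (b - a))"

lemma K3_eq: "K3 t = exp ((a + b + c) * t) * M t"
proof -
  define u v w where "u = exp (a * t)" "v = exp (b * t)" "w = exp (c * t)"
  have e: "exp ((a + b + c) * t) = u * v * w" "exp (-(c - a) * t) = u / w"
    "exp (-(c - b) * t) = v / w" "exp ((b - a) * t) = v / u" "exp ((c - a) * t) = w / u"
    "exp (-(b - a) * t) = u / v" "exp ((c - b) * t) = w / v"
    unfolding u_v_w_def by (simp_all add: exp_add exp_diff[symmetric] algebra_simps flip: exp_add)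
  have nz: "u \<noteq> 0" "v \<noteq> 0" "w \<noteq> 0" unfolding u_v_w_def by auto
  have "u * v * w * M t = (b - a)^3 * (u - v) * u * v + (c - b)^3 * (v - w) * v * w
       + (c - a)^3 * (u - w) * u * w
       + ((c - a) + (c - b)) * ((c - a) + (b - a)) * ((c - b) - (b - a)) * u * v * w"
    unfolding M_def e using nz by (simp add: field_simps)
  also have "\<dots> = K3 t"
    unfolding K3_def F_def u_v_w_def[symmetric] by (simp, algebra)
  finally show ?thesis unfolding e by simp
qed

text \<open>Only two of the six terms of the derivative are positive. Each is absorbed by a negative
  term, and the sign of \<open>t\<close> decides by which one; the two negative terms left over give
  strictness.\<close>

lemma M_deriv_neg: "\<exists>D<0. (M has_real_derivative D) (at t)"
proof -
  define p q where "p = b - a" "q = c - b"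
  have p: "0 \<le> p" and q: "0 \<le> q" and pq: "0 < p + q" using ab bc ac by (auto simp: p_q_def)
  have e: "b - a = p" "c - b = q" "c - a = p + q" by (auto simp: p_q_def)
  define D where "D = p^3 * (q * exp (-q * t) - (p+q) * exp (-(p+q)*t))
      + q^3 * (p * exp (p * t) - (p+q) * exp ((p+q)*t))
      - (p+q)^3 * (p * exp (-p*t) + q * exp (q * t))"
  have der: "(M has_real_derivative D) (at t)"
    unfolding M_def D_def e by (rule derivative_eq_intros refl | simp add: algebra_simps)+
  have pq3: "p^3 \<le> (p+q)^3" "q^3 \<le> (p+q)^3" using p q by (auto intro: power_mono)
  have "D < 0"
  proof (cases "t \<ge> 0")
    case True
    have 1: "p^3 * (q * exp (-q * t)) \<le> (p+q)^3 * (q * exp (q * t))"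
      using p q True pq3 by (intro mult_mono) (auto intro: order_trans[of _ 0] mult_nonneg_nonneg)
    have 2: "q^3 * (p * exp (p * t)) \<le> q^3 * ((p+q) * exp ((p+q) * t))"
      using p q True pq3 by (intro mult_mono) (auto intro: mult_right_mono)
    show ?thesis
    \<comment> \<open>Slopes may coincide: with \<open>p = 0\<close> both spare negative terms of
      the other case vanish, and strictness comes from the terms in \<open>q\<close> alone.\<close>
    proof (cases "p = 0")
      case True
      then show ?thesis using q pq unfolding D_def by (simp add: field_simps)
    next
      case False
      then have "0 < p^3 * ((p+q) * exp (-(p+q)*t))" "0 < (p+q)^3 * (p * exp (-p*t))"
        using p q by (auto intro!: mult_pos_pos)
      with 1 2 show ?thesis unfolding D_def by (simp add: algebra_simps)
    qed
  next
    case False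
    have 1: "q^3 * (p * exp (p * t)) \<le> (p+q)^3 * (p * exp (-p * t))"
      using p q False pq3 by (intro mult_mono) (auto simp: mult_le_0_iff intro: order_trans[of _ 0])
    have 2: "p^3 * (q * exp (-q * t)) \<le> p^3 * ((p+q) * exp (-(p+q) * t))"
      using p q False pq3 mult_nonneg_nonpos[of p t]
      by (intro mult_mono) (auto intro: mult_right_mono simp: algebra_simps)
    show ?thesis
    proof (cases "q = 0")
      case True
      then show ?thesis using p pq unfolding D_def by (simp add: field_simps)
    next
      case False
      then have "0 < (p+q)^3 * (q * exp (q*t))" "0 < q^3 * ((p+q) * exp ((p+q)*t))"
        using p q by (auto intro!: mult_pos_pos)
      with 1 2 show ?thesis unfolding D_def by (simp add: algebra_simps)
    qed
  qed
  with der show ?thesis by blast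
qed

lemma K3_zero_unique: "K3 s = 0 \<Longrightarrow> K3 t = 0 \<Longrightarrow> s = t"
proof -
  have "M t < M s" if "s < t" for s t
    using that DERIV_neg_imp_decreasing[of s t M] M_deriv_neg by blast
  then show "K3 s = 0 \<Longrightarrow> K3 t = 0 \<Longrightarrow> s = t"
    unfolding K3_eq by (metis exp_not_eq_zero linorder_neqE_linordered_idom mult_eq_0_iff order_less_irrefl)
qed

text \<open>This is P'^2 / P'' - 2 * P: as P' = \<open>F 1 / F 0\<close> and P'' is \<open>V\<close>
  over the square of \<open>F 0\<close>, the factors \<open>F 0\<close> cancel in the
  quotient.\<close>

definition h :: "real \<Rightarrow> real" where "h t = (F 1 t)\<^sup>2 / V t - 2 * ln (F 0 t)"

lemma V_deriv [derivative_intros]: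
  "(V has_real_derivative F 3 t * F 0 t - F 1 t * F 2 t) (at t)"
  unfolding V_def
  by (rule derivative_eq_intros refl | simp add: numeral_2_eq_2 numeral_3_eq_3 algebra_simps)+

text \<open>Differentiating the numerator of P'^2 / P'' yields 2 * P', which the term - 2 * P
  cancels; only the part with P''' survives.\<close>

lemma h_deriv: "(h has_real_derivative - (F 1 t)\<^sup>2 * K3 t / ((V t)\<^sup>2 * F 0 t)) (at t)"
proof -
  have nz: "V t \<noteq> 0" "F 0 t \<noteq> 0" using V_pos F_pos by (metis less_irrefl)+
  have "(h has_real_derivative
     ((2 * F 1 t * F 2 t) * V t - (F 1 t)\<^sup>2 * (F 3 t * F 0 t - F 1 t * F 2 t)) / (V t)\<^sup>2 - 2 * (F 1 t / F 0 t)) (at t)"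
    unfolding h_def using nz F_pos[of 0 t]
    by (auto intro!: derivative_eq_intros simp: numeral_2_eq_2 power2_eq_square algebra_simps)
  also have "((2 * F 1 t * F 2 t) * V t - (F 1 t)\<^sup>2 * (F 3 t * F 0 t - F 1 t * F 2 t)) / (V t)\<^sup>2 - 2 * (F 1 t / F 0 t)
     = (F 0 t * ((2 * F 1 t * F 2 t) * V t - (F 1 t)\<^sup>2 * (F 3 t * F 0 t - F 1 t * F 2 t)) - 2 * F 1 t * (V t)\<^sup>2) / ((V t)\<^sup>2 * F 0 t)"
    using nz by (simp add: field_simps)
  also have "F 0 t * ((2 * F 1 t * F 2 t) * V t - (F 1 t)\<^sup>2 * (F 3 t * F 0 t - F 1 t * F 2 t)) - 2 * F 1 t * (V t)\<^sup>2
     = - (F 1 t)\<^sup>2 * K3 t"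
    unfolding V_def K3_def by algebra
  finally show ?thesis .
qed

lemma h_zeros: "finite {t. h t = 0} \<and> card {t. h t = 0} \<le> 2"
proof (rule at_most_two_zeros[OF h_deriv])
  have nz: "- (F 1 t)\<^sup>2 * K3 t / ((V t)\<^sup>2 * F 0 t) = 0 \<longleftrightarrow> K3 t = 0" for t
    using V_pos[of t] F_pos[of 0 t] F_pos[of 1 t] by simp
  show "s = t" if "- (F 1 s)\<^sup>2 * K3 s / ((V s)\<^sup>2 * F 0 s) = 0" "- (F 1 t)\<^sup>2 * K3 t / ((V t)\<^sup>2 * F 0 t) = 0"
    for s t using that unfolding nz by (rule K3_zero_unique)
qed

definition mean :: "real \<Rightarrow> real" where "mean t = F 1 t / F 0 t"

lemma mean_deriv: "(mean has_real_derivative V t / (F 0 t)\<^sup>2) (at t)"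
proof -
  have "F 0 t \<noteq> 0" using F_pos by (metis less_irrefl)
  then show ?thesis unfolding mean_def V_def
    by (auto intro!: derivative_eq_intros simp: numeral_2_eq_2 power2_eq_square algebra_simps)
qed

lemma mean_strict_mono: "strict_mono mean"
  unfolding strict_mono_def
proof safe
  fix s t :: real assume "s < t"
  then show "mean s < mean t"
    using DERIV_pos_imp_increasing[of s t mean] mean_deriv V_pos F_pos
    by (metis divide_pos_pos zero_less_power)
qed

lemma mean_cont: "isCont mean t"
  using mean_deriv DERIV_isCont by blast

lemma mean_range:
  assumes "a < \<alpha>" "\<alpha> < c"
  obtains t where "mean t = \<alpha>"
proof -
  have F: "mean t - \<alpha> = ((a - \<alpha>) * exp (a * t) + (b - \<alpha>) * exp (b * t) + (c - \<alpha>) * exp (c * t)) / F 0 t" for t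
    using F_pos[of 0 t] unfolding mean_def by (simp add: field_simps) (simp add: F_def algebra_simps)
  obtain u where "0 \<le> (a - \<alpha>) * exp (a * u) + (b - \<alpha>) * exp (b * u) + (c - \<alpha>) * exp (c * u)"
    using weighted_exp_nonneg[OF ab bc assms] .
  then have u: "\<alpha> \<le> mean u" using F[of u] F_pos[of 0 u] by (metis diff_ge_0_iff_ge divide_nonneg_pos)
  \<comment> \<open>Reflection: for the negated exponents the same estimate becomes an upper bound
    for \<open>mean\<close>, attained at \<open>- s\<close>.\<close>
  obtain s where s: "0 \<le> (- c - - \<alpha>) * exp (- c * s) + (- b - - \<alpha>) * exp (- b * s) + (- a - - \<alpha>) * exp (- a * s)"
    by (rule weighted_exp_nonneg[of "- c" "- b" "- a" "- \<alpha>"]) (use ab bc assms in auto)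
  have "((a - \<alpha>) * exp (a * - s) + (b - \<alpha>) * exp (b * - s) + (c - \<alpha>) * exp (c * - s)) \<le> 0"
    using s by (simp add: algebra_simps)
  then have s: "mean (- s) \<le> \<alpha>" using F[of "- s"] F_pos[of 0 "- s"] by (metis diff_le_0_iff_le divide_nonpos_pos)
  have "- s \<le> u" using s u mean_strict_mono by (meson le_less_trans less_le_trans not_le strict_mono_less less_irrefl)
  then show ?thesis using IVT[of mean "- s" \<alpha> u] s u mean_cont that by blast
qed

text \<open>Legendre duality: with \<open>\<tau>\<close> inverse to \<open>mean\<close>, the
  derivative of P (\<tau> \<beta>) is \<beta> * \<tau>' \<beta>. Hence in L = P / \<beta> - \<tau>
  the terms with \<tau>' cancel and L' = - P / \<beta>^2; the second differentiation brings back
  \<tau>' = 1 / P''.\<close>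

lemma second_deriv:
  fixes L :: "real \<Rightarrow> real"
  assumes L: "\<And>t. L (mean t) = ln (F 0 t) / mean t - t"
    and \<alpha>: "a < \<alpha>" "\<alpha> < c"
  shows "deriv (deriv L) \<alpha> = - h (the_inv mean \<alpha>) / \<alpha>^3" (is ?A) "mean (the_inv mean \<alpha>) = \<alpha>" (is ?B)
proof -
  define \<tau> where "\<tau> = the_inv mean"
  have \<tau>_mean: "\<tau> (mean t) = t" for t
    unfolding \<tau>_def using mean_strict_mono by (simp add: strict_mono_imp_inj_on the_inv_f_f)
  have mean_\<tau>: "mean (\<tau> \<beta>) = \<beta>" if "\<beta> \<in> {a<..<c}" for \<beta>
    using that mean_range[of \<beta>] \<tau>_mean by (metis greaterThanLessThan_iff)
  show ?B using mean_\<tau> \<alpha> unfolding \<tau>_def by simp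
  have \<tau>_cont: "isCont \<tau> (mean t)" for t
    using isCont_inverse_function[of 1 t \<tau> mean] \<tau>_mean mean_cont by simp
  have \<tau>_deriv: "(\<tau> has_real_derivative (F 0 (\<tau> \<beta>))\<^sup>2 / V (\<tau> \<beta>)) (at \<beta>)" if \<beta>: "\<beta> \<in> {a<..<c}" for \<beta>
  proof -
    have "(\<tau> has_real_derivative inverse (V (\<tau> \<beta>) / (F 0 (\<tau> \<beta>))\<^sup>2)) (at \<beta>)"
      by (rule DERIV_inverse_function[where f=mean and a=a and b=c])
        (use \<beta> mean_\<tau> mean_deriv V_pos F_pos \<tau>_cont[of "\<tau> \<beta>"] in \<open>auto simp: less_imp_neq[THEN not_sym]\<close>)
    then show ?thesis by simp
  qed
  have P_deriv: "((\<lambda>\<beta>. ln (F 0 (\<tau> \<beta>))) has_real_derivative \<beta> * ((F 0 (\<tau> \<beta>))\<^sup>2 / V (\<tau> \<beta>))) (at \<beta>)"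
    if \<beta>: "\<beta> \<in> {a<..<c}" for \<beta>
  proof -
    have "((\<lambda>t. ln (F 0 t)) has_real_derivative mean (\<tau> \<beta>)) (at (\<tau> \<beta>))"
      unfolding mean_def using F_pos[of 0 "\<tau> \<beta>"] by (auto intro!: derivative_eq_intros)
    from DERIV_chain2[OF this \<tau>_deriv[OF \<beta>]] show ?thesis using mean_\<tau>[OF \<beta>] by simp
  qed
  have pos: "0 < \<beta>" if "\<beta> \<in> {a<..<c}" for \<beta> using that a0 by auto
  \<comment> \<open>The formulas for \<open>L\<close> and \<open>deriv L\<close> may be
    differentiated only because they hold in a neighbourhood of each point.\<close>
  have nhd: "eventually (\<lambda>\<gamma>. \<gamma> \<in> {a<..<c}) (nhds \<beta>)" if "\<beta> \<in> {a<..<c}" for \<beta>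
    using that by (intro eventually_nhds_in_open) auto
  have L1: "deriv L \<beta> = - ln (F 0 (\<tau> \<beta>)) / \<beta>\<^sup>2" if \<beta>: "\<beta> \<in> {a<..<c}" for \<beta>
  proof -
    have "((\<lambda>\<beta>. ln (F 0 (\<tau> \<beta>)) / \<beta> - \<tau> \<beta>) has_real_derivative - ln (F 0 (\<tau> \<beta>)) / \<beta>\<^sup>2) (at \<beta>)"
      by (rule DERIV_cong, rule DERIV_diff[OF DERIV_divide[OF P_deriv[OF \<beta>] DERIV_ident] \<tau>_deriv[OF \<beta>]])
        (use pos[OF \<beta>] in \<open>simp_all add: field_simps power2_eq_square\<close>)
    moreover have "eventually (\<lambda>\<gamma>. L \<gamma> = ln (F 0 (\<tau> \<gamma>)) / \<gamma> - \<tau> \<gamma>) (nhds \<beta>)"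
      using nhd[OF \<beta>] by eventually_elim (metis L mean_\<tau>)
    ultimately show ?thesis by (simp only: deriv_cong_ev[OF _ refl] DERIV_imp_deriv)
  qed
  have \<alpha>': "\<alpha> \<in> {a<..<c}" using \<alpha> by simp
  have "((\<lambda>\<beta>. - ln (F 0 (\<tau> \<beta>)) / \<beta>\<^sup>2) has_real_derivative - h (\<tau> \<alpha>) / \<alpha>^3) (at \<alpha>)"
  proof (rule DERIV_cong, rule DERIV_divide[OF DERIV_minus[OF P_deriv[OF \<alpha>']] DERIV_power[OF DERIV_ident]])
    have "F 1 (\<tau> \<alpha>) = \<alpha> * F 0 (\<tau> \<alpha>)"
      using mean_\<tau>[OF \<alpha>'] F_pos[of 0 "\<tau> \<alpha>"] unfolding mean_def by (auto simp: field_simps)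
    then show "(- (\<alpha> * ((F 0 (\<tau> \<alpha>))\<^sup>2 / V (\<tau> \<alpha>))) * \<alpha>\<^sup>2 - - ln (F 0 (\<tau> \<alpha>)) * (real 2 * (1 * \<alpha> ^ (2 - Suc 0)))) / (\<alpha>\<^sup>2 * \<alpha>\<^sup>2) = - h (\<tau> \<alpha>) / \<alpha> ^ 3"
      unfolding h_def using pos[OF \<alpha>'] V_pos[of "\<tau> \<alpha>"] by (simp add: field_simps power2_eq_square power3_eq_cube)
  qed (use pos[OF \<alpha>'] in auto)
  moreover have "eventually (\<lambda>\<gamma>. deriv L \<gamma> = - ln (F 0 (\<tau> \<gamma>)) / \<gamma>\<^sup>2) (nhds \<alpha>)"
    using nhd[OF \<alpha>'] by eventually_elim (rule L1)
  ultimately show ?A unfolding \<tau>_def[symmetric]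
    by (simp only: deriv_cong_ev[OF _ refl] DERIV_imp_deriv)
qed

lemma inflections_le_2:
  fixes L :: "real \<Rightarrow> real"
  assumes L: "\<And>t. L (mean t) = ln (F 0 t) / mean t - t"
  defines "I \<equiv> {\<alpha> \<in> {a<..<c}. deriv (deriv L) \<alpha> = 0}"
  shows "finite I \<and> card I \<le> 2"
proof -
  have "I \<subseteq> mean ` {t. h t = 0}"
  proof
    fix \<alpha> assume "\<alpha> \<in> I"
    then have \<alpha>: "a < \<alpha>" "\<alpha> < c" "deriv (deriv L) \<alpha> = 0" unfolding I_def by auto
    with second_deriv[OF L \<alpha>(1,2)] a0 have "h (the_inv mean \<alpha>) = 0" by simp
    then show "\<alpha> \<in> mean ` {t. h t = 0}"
      using second_deriv(2)[OF L \<alpha>(1,2)] by (intro image_eqI[of _ _ "the_inv mean \<alpha>"]) auto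
  qed
  moreover have "finite (mean ` {t. h t = 0})" "card (mean ` {t. h t = 0}) \<le> 2"
    using h_zeros card_image_le[of "{t. h t = 0}" mean] by auto
  ultimately show ?thesis
    using card_mono[of "mean ` {t. h t = 0}" I] finite_subset[of I] by simp
qed

end

section \<open>Cylinders and itineraries\<close>

text \<open>
  The proof picks for each interval a cell of the grid of mesh \<open>d / 4\<close> that it contains; only
  eleven cells are near \<open>U\<close>, and no two intervals share one.
\<close>

lemma card_intervals_meeting_le:
  fixes J :: "'w \<Rightarrow> real set" and d :: real
  assumes d: "0 < d"
    and J: "\<And>w. w \<in> W \<Longrightarrow> \<exists>l u. J w = {l..u} \<and> d \<le> u - l \<and> J w \<inter> U \<noteq> {}"
    and U: "\<And>x y. x \<in> U \<Longrightarrow> y \<in> U \<Longrightarrow> \<bar>x - y\<bar> \<le> d"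
    and nonoverlap: "\<And>v w x y. v \<in> W \<Longrightarrow> w \<in> W \<Longrightarrow> x < y \<Longrightarrow> {x<..<y} \<subseteq> J v \<Longrightarrow> {x<..<y} \<subseteq> J w \<Longrightarrow> v = w"
  shows "finite W \<and> card W \<le> 11"
proof (cases "U = {}")
  case True
  then have "W = {}" using J by auto
  then show ?thesis by simp
next
  case False
  then obtain z where z: "z \<in> U" by auto
  define e where "e = d / 4"
  have e: "0 < e" "d = 4 * e" using d unfolding e_def by auto
  have "\<exists>k\<in>{-6..4::int}. {z + of_int k * e <..< z + of_int k * e + e} \<subseteq> J w" if w: "w \<in> W" for w
  proof -
    obtain l u where lu: "J w = {l..u}" "4 * e \<le> u - l" and "J w \<inter> U \<noteq> {}"
      using J[OF w] unfolding e(2) by blast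
    then obtain y where y: "y \<in> U" "l \<le> y" "y \<le> u" by auto
    have yz: "\<bar>y - z\<bar> \<le> 4 * e" using U y z e by auto
    \<comment> \<open>An interval of length 4 * e around \<open>y\<close> has room for 2 * e on one
      side of \<open>y\<close>; rounding \<open>y0\<close> up to the grid then leaves a full cell
      inside. Since \<open>y\<close> is within 4 * e of \<open>z\<close> and \<open>y0\<close> may
      lie 2 * e further left, \<open>k\<close> runs from -6 to 4.\<close>
    define y0 where "y0 = (if y + 2 * e \<le> u then y else y - 2 * e)"
    have y0: "l \<le> y0" "y0 + 2 * e \<le> u" "z - 6 * e \<le> y0" "y0 \<le> z + 4 * e"
      using lu y yz e unfolding y0_def by auto
    define k where "k = \<lceil>(y0 - z) / e\<rceil>"
    have k: "y0 \<le> z + of_int k * e" "z + of_int k * e < y0 + e"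
    proof -
      have "(y0 - z) / e \<le> of_int k" "of_int k < (y0 - z) / e + 1"
        unfolding k_def by linarith+
      then show "y0 \<le> z + of_int k * e" "z + of_int k * e < y0 + e"
        using e by (simp_all add: field_simps)
    qed
    have "-6 \<le> k" "k \<le> 4"
    proof -
      have "-6 \<le> (y0 - z) / e" "(y0 - z) / e \<le> 4" using y0 e by (simp_all add: field_simps)
      then show "-6 \<le> k" "k \<le> 4" unfolding k_def by linarith+
    qed
    moreover have "{z + of_int k * e <..< z + of_int k * e + e} \<subseteq> J w"
    proof
      fix x assume "x \<in> {z + of_int k * e <..< z + of_int k * e + e}"
      then show "x \<in> J w"
        using k y0 unfolding lu(1) greaterThanLessThan_iff atLeastAtMost_iff by linarith
    qed
    ultimately show ?thesis by (intro bexI[of _ k]) (simp_all only: atLeastAtMost_iff)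
  qed
  then obtain \<kappa> where \<kappa>: "\<And>w. w \<in> W \<Longrightarrow> \<kappa> w \<in> {-6..4::int}"
    "\<And>w. w \<in> W \<Longrightarrow> {z + of_int (\<kappa> w) * e <..< z + of_int (\<kappa> w) * e + e} \<subseteq> J w"
    by metis
  have inj: "inj_on \<kappa> W"
  proof (rule inj_onI)
    fix v w assume vw: "v \<in> W" "w \<in> W" "\<kappa> v = \<kappa> w"
    show "v = w"
      by (rule nonoverlap[OF vw(1,2), of "z + of_int (\<kappa> v) * e" "z + of_int (\<kappa> v) * e + e"])
        (use e \<kappa>(2)[OF vw(1)] \<kappa>(2)[OF vw(2)] vw(3) in auto)
  qed
  have sub: "\<kappa> ` W \<subseteq> {-6..4}" using \<kappa>(1) by auto
  have "card W = card (\<kappa> ` W)" using inj by (simp add: card_image)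
  also have "\<dots> \<le> card {-6..4::int}" using sub by (intro card_mono) auto
  finally show ?thesis using inj sub finite_subset[OF sub] finite_imageD by auto
qed

text \<open>The existential witnesses of \<open>pl_expanding_map\<close> are fixed as parameters,
  and \<open>a i\<close> is the logarithm of the slope of branch \<open>i\<close>. The number of
  branches is general: only the calculus above depends on there being three.\<close>

locale piecewise_linear =
  fixes n :: nat and X :: "nat \<Rightarrow> real set" and T :: "real \<Rightarrow> real"
    and g :: "nat \<Rightarrow> real \<Rightarrow> real" and a c d lo hi :: "nat \<Rightarrow> real"
  assumes X_eq: "\<And>i. i \<in> {1..n} \<Longrightarrow> X i = {lo i..hi i}"
    and lo_hi: "\<And>i. i \<in> {1..n} \<Longrightarrow> lo i < hi i"
    and X_sub: "\<And>i. i \<in> {1..n} \<Longrightarrow> X i \<subseteq> {0..1}"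
    and X_disj: "disjoint_family_on (\<lambda>i. interior (X i)) {1..n}"
    and g_eq: "\<And>i x. i \<in> {1..n} \<Longrightarrow> g i x = c i * x + d i"
    and g_onto: "\<And>i. i \<in> {1..n} \<Longrightarrow> g i ` X i = {0..1}"
    and c_abs: "\<And>i. i \<in> {1..n} \<Longrightarrow> \<bar>c i\<bar> = exp (a i)"
    and a_pos: "\<And>i. i \<in> {1..n} \<Longrightarrow> 0 < a i"
    and T_eq: "\<And>x. x \<in> branch_union n X \<Longrightarrow> \<exists>i\<in>{1..n}. x \<in> X i \<and> T x = g i x"
begin

lemma c_nz: "i \<in> {1..n} \<Longrightarrow> c i \<noteq> 0"
  using c_abs[of i] by auto

lemma g_inj: "i \<in> {1..n} \<Longrightarrow> g i x = g i y \<longleftrightarrow> x = y"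
  using g_eq c_nz by simp

lemma mem_X_of_g: "i \<in> {1..n} \<Longrightarrow> g i x \<in> {0..1} \<Longrightarrow> x \<in> X i"
  using g_onto[of i] g_inj[of i] by (metis imageE)

text \<open>Built from \<open>g i\<close> and not from \<open>T\<close>, so that cylinders are exact
  closed intervals whatever value \<open>T\<close> takes at a common endpoint.\<close>

fun cyl :: "nat list \<Rightarrow> real set" where
  "cyl [] = {0..1}"
| "cyl (i # w) = {x \<in> X i. g i x \<in> cyl w}"

definition S :: "nat list \<Rightarrow> real" where "S w = sum_list (map a w)"

lemma S_simps [simp]: "S [] = 0" "S (i # w) = a i + S w" "S (v @ w) = S v + S w"
  by (simp_all add: S_def)

lemma cyl_sub: "set w \<subseteq> {1..n} \<Longrightarrow> cyl w \<subseteq> {0..1}"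
  using X_sub by (cases w) auto

text \<open>Each letter pulls an interval back through an affine bijection whose slope has modulus
  exp (a i). The constraint to \<open>X i\<close> is automatic, since \<open>g i\<close> is
  injective and maps \<open>X i\<close> onto the unit interval.\<close>

lemma cyl_interval: "set w \<subseteq> {1..n} \<Longrightarrow> \<exists>l u. cyl w = {l..u} \<and> u - l = exp (- S w)"
proof (induction w)
  case Nil
  show ?case by (intro exI[of _ 0] exI[of _ 1]) simp
next
  case (Cons i w)
  then obtain l u where lu: "cyl w = {l..u}" "u - l = exp (- S w)" by auto
  have i: "i \<in> {1..n}" using Cons by simp
  have sub: "{l..u} \<subseteq> {0..1}" using cyl_sub[of w] Cons lu by simp
  have eq: "cyl (i # w) = {x. c i * x + d i \<in> {l..u}}"
    using mem_X_of_g[OF i] sub lu g_eq[OF i] by auto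
  show ?case
  proof (cases "c i > 0")
    case True
    then have "c i = exp (a i)" using c_abs[OF i] by simp
    moreover have "cyl (i # w) = {(l - d i) / c i..(u - d i) / c i}"
      unfolding eq using True by (auto simp: field_simps)
    ultimately show ?thesis using lu(2)
      by (intro exI[of _ "(l - d i) / c i"] exI[of _ "(u - d i) / c i"])
        (simp add: diff_divide_distrib[symmetric] exp_diff[symmetric] del: cyl.simps)
  next
    case False
    then have neg: "c i < 0" using c_nz[OF i] by simp
    then have "c i = - exp (a i)" using c_abs[OF i] by simp
    moreover have "cyl (i # w) = {(u - d i) / c i..(l - d i) / c i}"
      unfolding eq using neg by (auto simp: field_simps)
    moreover have "(l - d i) / c i - (u - d i) / c i = (u - l) / (- c i)"
      using neg by (simp add: field_simps)
    ultimately show ?thesis using lu(2)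
      by (intro exI[of _ "(u - d i) / c i"] exI[of _ "(l - d i) / c i"])
        (simp add: exp_diff[symmetric] del: cyl.simps)
  qed
qed

lemma
  assumes "set w \<subseteq> {1..n}"
  shows diameter_cyl: "diameter (cyl w) = exp (- S w)"
    and compact_cyl: "compact (cyl w)"
    and cyl_nonempty: "cyl w \<noteq> {}"
proof -
  obtain l u where lu: "cyl w = {l..u}" "u - l = exp (- S w)" using cyl_interval[OF assms] by blast
  moreover have "l \<le> u" using lu(2) exp_ge_zero[of "- S w"] by linarith
  ultimately show "diameter (cyl w) = exp (- S w)" "compact (cyl w)" "cyl w \<noteq> {}"
    by (simp_all add: diameter_closed_interval)
qed

lemma cyl_append: "set (v @ w) \<subseteq> {1..n} \<Longrightarrow> cyl (v @ w) \<subseteq> cyl v"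
  using cyl_sub[of w] by (induction v) auto

text \<open>Phrased with open intervals because distinct cylinders may share an endpoint. A common
  open interval lies in the interiors of both first branches, so the first letters agree; its image
  under that branch contains an open interval common to the two tails.\<close>

lemma cyl_nonoverlap:
  assumes "length v = length w" "set v \<subseteq> {1..n}" "set w \<subseteq> {1..n}"
    and "x < y" "{x<..<y} \<subseteq> cyl v" "{x<..<y} \<subseteq> cyl w"
  shows "v = w"
  using assms
proof (induction v w arbitrary: x y rule: list_induct2)
  case Nil
  then show ?case by simp
next
  case (Cons i v j w)
  have ij: "i \<in> {1..n}" "j \<in> {1..n}" using Cons by auto
  have "{x<..<y} \<subseteq> X i" "{x<..<y} \<subseteq> X j" using Cons.prems by auto
  then have "{x<..<y} \<subseteq> interior (X i)" "{x<..<y} \<subseteq> interior (X j)"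
    using interior_maximal[OF _ open_greaterThanLessThan] by blast+
  moreover have "(x + y) / 2 \<in> {x<..<y}" using Cons.prems by auto
  ultimately have "i = j" using X_disj ij unfolding disjoint_family_on_def by blast
  define x' y' where "x' = min (g i x) (g i y)" and "y' = max (g i x) (g i y)"
  have "x' < y'" using g_inj[OF ij(1), of x y] \<open>x < y\<close> unfolding x'_def y'_def by auto
  have img: "\<exists>z\<in>{x<..<y}. g i z = q" if "q \<in> {x'<..<y'}" for q
  proof (intro bexI[of _ "(q - d i) / c i"])
    show "g i ((q - d i) / c i) = q" using g_eq[OF ij(1)] c_nz[OF ij(1)] by simp
    show "(q - d i) / c i \<in> {x<..<y}"
    proof (cases "c i > 0")
      case True
      then have "c i * x < c i * y" using Cons.prems by simp
      then show ?thesis using that True unfolding x'_def y'_def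
        by (auto simp: g_eq[OF ij(1)] field_simps)
    next
      case False
      then have "c i < 0" using c_nz[OF ij(1)] by simp
      moreover then have "c i * y < c i * x" using Cons.prems by simp
      ultimately show ?thesis using that unfolding x'_def y'_def
        by (auto simp: g_eq[OF ij(1)] field_simps)
    qed
  qed
  have "{x'<..<y'} \<subseteq> cyl v" "{x'<..<y'} \<subseteq> cyl w"
    using img Cons.prems \<open>i = j\<close> by fastforce+
  with Cons.IH[OF _ _ \<open>x' < y'\<close>] Cons.prems \<open>i = j\<close> show ?case by simp
qed

text \<open>Each \<open>X j\<close> is the closure of its interior. An interior point of
  \<open>X i\<close> lying in another \<open>X j\<close> would make the two interiors meet, so
  \<open>T\<close> has no choice there.\<close>

lemma T_on_interior:
  assumes i: "i \<in> {1..n}" and z: "z \<in> interior (X i)"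
  shows "T z = g i z"
proof -
  have "z \<in> branch_union n X" using i z interior_subset unfolding branch_union_def by blast
  then obtain j where j: "j \<in> {1..n}" "z \<in> X j" "T z = g j z" using T_eq by blast
  have "z \<in> closure (interior (X j))"
    using j X_eq[of j] lo_hi[of j] by (simp add: closure_greaterThanLessThan)
  then have "interior (X i) \<inter> interior (X j) \<noteq> {}"
    using z open_Int_closure_eq_empty[OF open_interior] by blast
  then have "i = j" using X_disj i j unfolding disjoint_family_on_def by blast
  then show ?thesis using j by simp
qed

definition itinerary :: "real \<Rightarrow> (nat \<Rightarrow> nat) \<Rightarrow> bool" where
  "itinerary x \<omega> \<longleftrightarrow> (\<forall>k. \<omega> k \<in> {1..n} \<and> (T ^^ k) x \<in> interior (X (\<omega> k)))"

text \<open>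
  The points whose orbit meets an endpoint of a branch. They are countably many, hence irrelevant
  for the dimension, and at every other point of the repeller the itinerary is unique and the
  iterates of \<open>T\<close> are differentiable.
\<close>

primrec E :: "nat \<Rightarrow> real set" where
  "E 0 = (\<Union>i\<in>{1..n}. X i - interior (X i))"
| "E (Suc k) = {x \<in> branch_union n X. T x \<in> E k}"

lemma countable_E: "countable (E k)"
proof (induction k)
  case 0
  have "X i - interior (X i) \<subseteq> {lo i, hi i}" if "i \<in> {1..n}" for i
    using X_eq[OF that] by auto
  then have "countable (X i - interior (X i))" if "i \<in> {1..n}" for i
    using that by (meson countable_finite finite.emptyI finite.insertI finite_subset)
  then show ?case
    unfolding E.simps by (rule countable_UN[OF countable_finite[OF finite_atLeastAtMost]])
next
  case (Suc k)
  have "E (Suc k) \<subseteq> (\<Union>i\<in>{1..n}. g i -` E k)" using T_eq by fastforce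
  moreover have "countable (g i -` E k)" if "i \<in> {1..n}" for i
  proof (rule countable_image_inj_on)
    show "countable (g i ` (g i -` E k))"
      by (rule countable_subset[OF _ Suc]) auto
    show "inj_on (g i) (g i -` E k)" using g_inj[OF that] by (auto intro: inj_onI)
  qed
  ultimately show ?case by (meson countable_UN countable_finite countable_subset finite_atLeastAtMost)
qed

lemma repeller_iff: "x \<in> repeller n X T \<longleftrightarrow> (\<forall>k. (T ^^ k) x \<in> branch_union n X)"
  unfolding repeller_def by auto

lemma iterate_mem_E:
  "(\<And>j. j < k \<Longrightarrow> (T ^^ j) x \<in> branch_union n X) \<Longrightarrow> (T ^^ k) x \<in> E 0 \<Longrightarrow> x \<in> E k"
proof (induction k arbitrary: x)
  case (Suc k)
  have "T x \<in> E k"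
  proof (rule Suc.IH)
    show "(T ^^ j) (T x) \<in> branch_union n X" if "j < k" for j
      using Suc.prems(1)[of "Suc j"] that by (simp add: funpow_swap1)
    show "(T ^^ k) (T x) \<in> E 0" using Suc.prems(2) by (simp add: funpow_swap1)
  qed
  then show ?case using Suc.prems(1)[of 0] by simp
qed simp

lemma itinerary_exists:
  assumes x: "x \<in> repeller n X T" "x \<notin> (\<Union>k. E k)"
  shows "\<exists>\<omega>. itinerary x \<omega>"
proof -
  have "\<exists>i\<in>{1..n}. (T ^^ k) x \<in> interior (X i)" for k
  proof -
    have "(T ^^ k) x \<in> branch_union n X" using x repeller_iff by blast
    moreover have "(T ^^ k) x \<notin> E 0" using iterate_mem_E[of k x] x repeller_iff by blast
    ultimately show ?thesis unfolding branch_union_def by auto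
  qed
  then show ?thesis unfolding itinerary_def by metis
qed

lemma itinerary_step: "itinerary x \<omega> \<Longrightarrow> (T ^^ Suc k) x = g (\<omega> k) ((T ^^ k) x)"
  using T_on_interior unfolding itinerary_def by simp

lemma itinerary_shift: "itinerary x \<omega> \<Longrightarrow> itinerary (T x) (\<lambda>k. \<omega> (Suc k))"
  unfolding itinerary_def
proof
  fix k
  assume "\<forall>k. \<omega> k \<in> {1..n} \<and> (T ^^ k) x \<in> interior (X (\<omega> k))"
  from spec[OF this, of "Suc k"]
  show "\<omega> (Suc k) \<in> {1..n} \<and> (T ^^ k) (T x) \<in> interior (X (\<omega> (Suc k)))"
    by (simp only: funpow_Suc_right comp_apply)
qed

lemma itinerary_cyl: "itinerary x \<omega> \<Longrightarrow> x \<in> cyl (map \<omega> [0..<m])"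
proof (induction m arbitrary: x \<omega>)
  case 0
  then have "\<omega> 0 \<in> {1..n}" "x \<in> X (\<omega> 0)" unfolding itinerary_def using interior_subset
    by (metis, metis funpow_0 subsetD)
  then show ?case using X_sub[of "\<omega> 0"] by auto
next
  case (Suc m)
  have "map \<omega> [0..<Suc m] = \<omega> 0 # map (\<lambda>k. \<omega> (Suc k)) [0..<m]"
    by (simp add: map_upt_Suc del: upt_Suc)
  moreover have "x \<in> X (\<omega> 0)" "\<omega> 0 \<in> {1..n}"
    using Suc.prems unfolding itinerary_def using interior_subset by (metis funpow_0 subsetD, metis)
  moreover have "T x = g (\<omega> 0) x" using itinerary_step[OF Suc.prems, of 0] by simp
  ultimately show ?case using Suc.IH[OF itinerary_shift[OF Suc.prems]] by simp
qed

lemma branch_deriv: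
  assumes i: "i \<in> {1..n}" and y: "y \<in> interior (X i)"
  shows "(T has_real_derivative c i) (at y)"
proof -
  have "(g i has_real_derivative c i) (at y)"
    unfolding g_eq[OF i, abs_def] by (auto intro!: derivative_eq_intros)
  then show ?thesis
    by (rule has_field_derivative_transform_within_open[OF _ open_interior y])
      (use T_on_interior[OF i] in auto)
qed

lemma iterate_deriv:
  assumes "itinerary x \<omega>"
  shows "((T ^^ m) has_real_derivative (\<Prod>k<m. c (\<omega> k))) (at x)"
proof (induction m)
  case 0
  show ?case by (simp add: id_def)
next
  case (Suc m)
  have "(T has_real_derivative c (\<omega> m)) (at ((T ^^ m) x))"
    using assms branch_deriv unfolding itinerary_def by blast
  from DERIV_chain[OF this Suc] show ?case by (simp add: mult.commute comp_def)
qed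

text \<open>This turns the derivative within the domain, used by
  \<open>has_lyapunov_exponent\<close>, into an ordinary two-sided one, which is unique.\<close>

lemma interior_iterate_dom:
  assumes "itinerary x \<omega>"
  shows "x \<in> interior (iterate_dom n X T m)"
proof -
  have "eventually (\<lambda>z. (T ^^ k) z \<in> branch_union n X) (nhds x)" for k
  proof -
    have "((T ^^ k) \<longlongrightarrow> (T ^^ k) x) (nhds x)"
      using DERIV_isCont[OF iterate_deriv[OF assms]] isCont_def tendsto_at_iff_tendsto_nhds by blast
    then have "eventually (\<lambda>z. (T ^^ k) z \<in> interior (X (\<omega> k))) (nhds x)"
      using assms open_interior topological_tendstoD unfolding itinerary_def by blast
    then show ?thesis
      by eventually_elim (use assms interior_subset in \<open>unfold itinerary_def branch_union_def; blast\<close>)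
  qed
  then have "eventually (\<lambda>z. \<forall>k\<in>{..<m}. (T ^^ k) z \<in> branch_union n X) (nhds x)"
    by (intro eventually_ball_finite) auto
  then have "eventually (\<lambda>z. z \<in> iterate_dom n X T m) (nhds x)"
    unfolding iterate_dom_def by simp
  then show ?thesis unfolding eventually_nhds interior_def by blast
qed

text \<open>The chain rule gives the derivatives as products of the \<open>c (\<omega> k)\<close>,
  and uniqueness fixes the witness \<open>D\<close>; the exponent becomes a Birkhoff average of
  \<open>a\<close>.\<close>

lemma exponent_iff:
  assumes "itinerary x \<omega>"
  shows "has_lyapunov_exponent n X T x \<alpha> \<longleftrightarrow> (\<lambda>m. (\<Sum>k<m. a (\<omega> k)) / real m) \<longlonglongrightarrow> \<alpha>"
proof -
  have at: "at x within iterate_dom n X T m = at x" for m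
    using interior_iterate_dom[OF assms] at_within_interior by blast
  have D: "D = (\<lambda>m. \<Prod>k<m. c (\<omega> k))" if "\<forall>m. ((T ^^ m) has_real_derivative D m) (at x)" for D
    using that iterate_deriv[OF assms] DERIV_unique by blast
  have "\<bar>\<Prod>k<m. c (\<omega> k)\<bar> = exp (\<Sum>k<m. a (\<omega> k))" for m
    using assms c_abs unfolding itinerary_def by (simp add: abs_prod exp_sum)
  then have "(\<lambda>m. 1 / real m * ln \<bar>\<Prod>k<m. c (\<omega> k)\<bar>) = (\<lambda>m. (\<Sum>k<m. a (\<omega> k)) / real m)"
    by (simp add: fun_eq_iff)
  note eq = this
  show ?thesis unfolding has_lyapunov_exponent_def at
  proof
    assume "\<exists>D. (\<forall>m. ((T ^^ m) has_real_derivative D m) (at x)) \<and> (\<lambda>m. 1 / real m * ln \<bar>D m\<bar>) \<longlonglongrightarrow> \<alpha>"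
    then obtain D' where "\<forall>m. ((T ^^ m) has_real_derivative D' m) (at x)" "(\<lambda>m. 1 / real m * ln \<bar>D' m\<bar>) \<longlonglongrightarrow> \<alpha>"
      by blast
    with D[of D'] eq show "(\<lambda>m. (\<Sum>k<m. a (\<omega> k)) / real m) \<longlonglongrightarrow> \<alpha>" by simp
  next
    assume "(\<lambda>m. (\<Sum>k<m. a (\<omega> k)) / real m) \<longlonglongrightarrow> \<alpha>"
    then show "\<exists>D. (\<forall>m. ((T ^^ m) has_real_derivative D m) (at x)) \<and> (\<lambda>m. 1 / real m * ln \<bar>D m\<bar>) \<longlonglongrightarrow> \<alpha>"
      using eq iterate_deriv[OF assms] by (intro exI[of _ "\<lambda>m. \<Prod>k<m. c (\<omega> k)"]) simp
  qed
qed

lemma coded_point_exists: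
  assumes "\<And>k. \<omega> k \<in> {1..n}"
  shows "\<exists>x. \<forall>m. x \<in> cyl (map \<omega> [0..<m])"
proof -
  have set: "set (map \<omega> [0..<m]) \<subseteq> {1..n}" for m using assms by auto
  have "\<Inter>(range (\<lambda>m. cyl (map \<omega> [0..<m]))) \<noteq> {}"
  proof (rule compact_nest)
    fix m k :: nat assume "m \<le> k"
    then have "map \<omega> [0..<k] = map \<omega> [0..<m] @ map \<omega> [m..<k]"
      using upt_add_eq_append[of 0 m "k - m"] by simp
    then show "cyl (map \<omega> [0..<k]) \<subseteq> cyl (map \<omega> [0..<m])"
      using cyl_append[of "map \<omega> [0..<m]" "map \<omega> [m..<k]"] set[of k] by metis
  qed (use compact_cyl[OF set] cyl_nonempty[OF set] in auto)
  then show ?thesis by auto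
qed

lemma coded_point_itinerary:
  assumes \<omega>: "\<And>k. \<omega> k \<in> {1..n}" and x: "\<And>m. x \<in> cyl (map \<omega> [0..<m])"
    and E: "x \<notin> (\<Union>k. E k)"
  shows "x \<in> repeller n X T \<and> itinerary x \<omega>"
proof -
  \<comment> \<open>The two claims need each other: \<open>T\<close> acts as the branch map only at
    interior points, which moves cylinder membership to the next iterate; membership then puts that
    iterate in its branch, and avoiding \<open>E\<close> puts it in the interior.\<close>
  have step: "(T ^^ k) x \<in> interior (X (\<omega> k)) \<and> (\<forall>m. (T ^^ k) x \<in> cyl (map \<omega> [k..<k + m]))" for k
  proof (induction k rule: less_induct)
    case (less k)
    have BU: "(T ^^ j) x \<in> branch_union n X" if "j < k" for j
      using less[OF that] \<omega> interior_subset unfolding branch_union_def by blast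
    have cyl: "(T ^^ k) x \<in> cyl (map \<omega> [k..<k + m])" for m
    proof (cases k)
      case 0
      then show ?thesis using x by simp
    next
      case (Suc j)
      have "(T ^^ j) x \<in> cyl (map \<omega> [j..<j + Suc m])" using less[of j] Suc by blast
      then have "g (\<omega> j) ((T ^^ j) x) \<in> cyl (map \<omega> [Suc j..<Suc j + m])"
        by (simp add: upt_conv_Cons del: upt_Suc)
      then show ?thesis using less[of j] Suc T_on_interior[OF \<omega>, of "(T ^^ j) x" j] by simp
    qed
    have "(T ^^ k) x \<in> X (\<omega> k)" using cyl[of 1] by simp
    moreover have "(T ^^ k) x \<notin> E 0" using iterate_mem_E[of k x] BU E by blast
    ultimately show ?case using cyl \<omega>[of k] by auto
  qed
  then show ?thesis
    unfolding itinerary_def repeller_iff branch_union_def using \<omega> interior_subset by blast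
qed

end

section \<open>Hausdorff null sets\<close>

lemma hausdorff_premeasure_mono:
  "A \<subseteq> B \<Longrightarrow> hausdorff_premeasure s \<delta> A \<le> hausdorff_premeasure s \<delta> B"
  unfolding hausdorff_premeasure_def by (rule INF_superset_mono) auto

lemma hausdorff_premeasure_le:
  assumes "A \<subseteq> (\<Union>i::nat. U i)" "\<And>i. bounded (U i)" "\<And>i. diameter (U i) \<le> \<delta>"
  shows "hausdorff_premeasure s \<delta> A \<le> (\<Sum>i. ennreal (hausdorff_gauge s (U i)))"
  unfolding hausdorff_premeasure_def using assms by (intro INF_lower) auto

lemma hausdorff_premeasure_less:
  assumes "hausdorff_premeasure s \<delta> A < e"
  obtains U where "A \<subseteq> (\<Union>i::nat. U i)" "\<And>i. bounded (U i)" "\<And>i. diameter (U i) \<le> \<delta>"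
    "(\<Sum>i. ennreal (hausdorff_gauge s (U i))) < e"
  using assms unfolding hausdorff_premeasure_def INF_less_iff by auto

lemma hausdorff_premeasure_finite_cover:
  assumes W: "finite W" and A: "A \<subseteq> (\<Union>w\<in>W. J w)" and \<delta>: "0 \<le> \<delta>"
    and J: "\<And>w. w \<in> W \<Longrightarrow> bounded (J w)" "\<And>w. w \<in> W \<Longrightarrow> diameter (J w) \<le> \<delta>"
  shows "hausdorff_premeasure s \<delta> A \<le> (\<Sum>w\<in>W. ennreal (hausdorff_gauge s (J w)))"
proof -
  obtain f where f: "bij_betw f {0..<card W} W" using ex_bij_betw_nat_finite[OF W] by blast
  define U where "U i = (if i < card W then J (f i) else {})" for i
  have fW: "f i \<in> W" if "i < card W" for i using f that by (auto simp: bij_betw_def)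
  have "A \<subseteq> (\<Union>i. U i)"
  proof
    fix x assume "x \<in> A"
    then obtain w where w: "w \<in> W" "x \<in> J w" using A by auto
    then have "w \<in> f ` {0..<card W}" using f by (simp add: bij_betw_def)
    then obtain i where "i < card W" "w = f i" by auto
    with w show "x \<in> (\<Union>i. U i)" unfolding U_def by auto
  qed
  then have "hausdorff_premeasure s \<delta> A \<le> (\<Sum>i. ennreal (hausdorff_gauge s (U i)))"
    by (rule hausdorff_premeasure_le) (use J fW \<delta> in \<open>auto simp: U_def\<close>)
  also have "\<dots> = (\<Sum>i\<in>{0..<card W}. ennreal (hausdorff_gauge s (U i)))"
    by (rule suminf_finite) (auto simp: U_def hausdorff_gauge_def)
  also have "\<dots> = (\<Sum>i\<in>{0..<card W}. ennreal (hausdorff_gauge s (J (f i))))"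
    by (rule sum.cong) (auto simp: U_def)
  also have "\<dots> = (\<Sum>w\<in>W. ennreal (hausdorff_gauge s (J w)))"
    by (rule sum.reindex_bij_betw[OF f])
  finally show ?thesis .
qed

lemma suminf_ennreal_geometric: "(\<Sum>k. ennreal (\<eta> * (1/2)^Suc k)) = ennreal \<eta>" if "0 \<le> \<eta>"
  using that power_half_series[THEN sums_mult, of \<eta>]
  by (intro suminf_ennreal_eq) auto

text \<open>The \<open>k\<close>-th set gets a cover of cost below \<eta> / 2^(k + 1), and a pairing
  function merges all covers into one sequence.\<close>

lemma hausdorff_premeasure_UN_null:
  assumes "\<And>k::nat. hausdorff_premeasure s \<delta> (A k) = 0"
  shows "hausdorff_premeasure s \<delta> (\<Union>k. A k) = 0"
proof -
  have "hausdorff_premeasure s \<delta> (\<Union>k. A k) \<le> ennreal \<eta>" if \<eta>: "0 < \<eta>" for \<eta>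
  proof -
    have "\<exists>U. A k \<subseteq> (\<Union>i::nat. U i) \<and> (\<forall>i. bounded (U i) \<and> diameter (U i) \<le> \<delta>) \<and>
        (\<Sum>i. ennreal (hausdorff_gauge s (U i))) < ennreal (\<eta> * (1/2)^Suc k)" for k
      by (rule hausdorff_premeasure_less[of s \<delta> "A k" "ennreal (\<eta> * (1/2)^Suc k)"])
        (use assms \<eta> in \<open>auto\<close>)
    then obtain U where U: "\<And>k. A k \<subseteq> (\<Union>i::nat. U k i)"
      "\<And>k i. bounded (U k i)" "\<And>k i. diameter (U k i) \<le> \<delta>"
      "\<And>k. (\<Sum>i. ennreal (hausdorff_gauge s (U k i))) < ennreal (\<eta> * (1/2)^Suc k)"
      by metis
    define V where "V p = U (fst (prod_decode p)) (snd (prod_decode p))" for p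
    have "(\<Union>k. A k) \<subseteq> (\<Union>p. V p)"
    proof
      fix x assume "x \<in> (\<Union>k. A k)"
      then obtain k i where "x \<in> U k i" using U(1) by blast
      then have "x \<in> V (prod_encode (k, i))" unfolding V_def by simp
      then show "x \<in> (\<Union>p. V p)" by blast
    qed
    then have "hausdorff_premeasure s \<delta> (\<Union>k. A k) \<le> (\<Sum>p. ennreal (hausdorff_gauge s (V p)))"
      by (rule hausdorff_premeasure_le) (use U in \<open>auto simp: V_def\<close>)
    also have "\<dots> = (\<Sum>p. (\<lambda>(k, i). ennreal (hausdorff_gauge s (U k i))) (prod_decode p))"
      unfolding V_def by (simp add: case_prod_beta)
    also have "\<dots> = (\<Sum>k. \<Sum>i. ennreal (hausdorff_gauge s (U k i)))"
      by (rule suminf_ennreal_2dimen) simp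
    also have "\<dots> \<le> (\<Sum>k. ennreal (\<eta> * (1/2)^Suc k))"
      using U(4) by (intro suminf_le) (auto simp del: power_Suc intro: less_imp_le)
    also have "\<dots> = ennreal \<eta>" by (rule suminf_ennreal_geometric) (use \<eta> in simp)
    finally show ?thesis .
  qed
  then show ?thesis
    by (metis ennreal_le_epsilon add_0 le_zero_eq)
qed

lemma hausdorff_measure_eq_0_iff:
  "hausdorff_measure s A = 0 \<longleftrightarrow> (\<forall>\<delta>>0. hausdorff_premeasure s \<delta> A = 0)"
proof -
  have "hausdorff_measure s A \<le> 0 \<longleftrightarrow> (\<forall>\<delta>>0. hausdorff_premeasure s \<delta> A \<le> 0)"
    unfolding hausdorff_measure_def SUP_le_iff by auto
  then show ?thesis by simp
qed

lemma hausdorff_null_subset: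
  "A \<subseteq> B \<Longrightarrow> hausdorff_measure s B = 0 \<Longrightarrow> hausdorff_measure s A = 0"
  unfolding hausdorff_measure_eq_0_iff using hausdorff_premeasure_mono by (metis le_zero_eq)

lemma hausdorff_null_UN:
  "(\<And>k::nat. hausdorff_measure s (A k) = 0) \<Longrightarrow> hausdorff_measure s (\<Union>k. A k) = 0"
  unfolding hausdorff_measure_eq_0_iff using hausdorff_premeasure_UN_null by blast

lemma hausdorff_null_Un:
  assumes "hausdorff_measure s A = 0" "hausdorff_measure s B = 0"
  shows "hausdorff_measure s (A \<union> B) = 0"
proof -
  have "hausdorff_measure s (\<Union>k. if k = (0::nat) then A else B) = 0"
    using assms by (intro hausdorff_null_UN) auto
  then show ?thesis by (rule hausdorff_null_subset[rotated]) (auto split: if_splits)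
qed

lemma hausdorff_null_singleton:
  assumes "0 < s"
  shows "hausdorff_measure s {x} = 0"
  unfolding hausdorff_measure_eq_0_iff
proof (intro allI impI)
  fix \<delta> :: real assume "0 < \<delta>"
  then have "hausdorff_premeasure s \<delta> {x} \<le> (\<Sum>w\<in>{x}. ennreal (hausdorff_gauge s {w}))"
    by (intro hausdorff_premeasure_finite_cover) auto
  then show "hausdorff_premeasure s \<delta> {x} = 0" using assms by (simp add: hausdorff_gauge_def)
qed

lemma hausdorff_null_countable:
  assumes "0 < s" "countable C"
  shows "hausdorff_measure s C = 0"
proof (cases "C = {}")
  case True
  then show ?thesis using hausdorff_null_subset[OF _ hausdorff_null_singleton[OF assms(1)]] by blast
next
  case False
  then have "C \<subseteq> (\<Union>k. {from_nat_into C k})"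
    using assms(2) from_nat_into_surj[of C] by fastforce
  then show ?thesis
    by (rule hausdorff_null_subset) (intro hausdorff_null_UN hausdorff_null_singleton assms(1))
qed

text \<open>At exponent 0 every nonempty covering set costs 1. This settles \<open>s = 0\<close> in
  the infimum defining the dimension, since the other nullity results concern positive
  exponents.\<close>

lemma hausdorff_measure_0_null:
  assumes "hausdorff_measure 0 A = 0"
  shows "A = {}"
proof (rule ccontr)
  assume "A \<noteq> {}"
  then obtain x where x: "x \<in> A" by auto
  have "hausdorff_premeasure 0 1 A < 1" using assms unfolding hausdorff_measure_eq_0_iff by simp
  then obtain U where U: "A \<subseteq> (\<Union>i::nat. U i)" "(\<Sum>i. ennreal (hausdorff_gauge 0 (U i))) < 1"
    by (rule hausdorff_premeasure_less) auto
  obtain i where "x \<in> U i" using x U by auto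
  then have "1 = (\<Sum>i\<in>{i}. ennreal (hausdorff_gauge 0 (U i)))" by (auto simp: hausdorff_gauge_def)
  also have "\<dots> \<le> (\<Sum>i. ennreal (hausdorff_gauge 0 (U i)))" by (rule sum_le_suminf) auto
  finally show False using U(2) by simp
qed

section \<open>Dimension of the level sets\<close>

lemma exists_DERIV_neg_less:
  fixes f :: "real \<Rightarrow> real"
  assumes "(f has_real_derivative D) (at 0)" "D < 0"
  obtains \<theta> where "0 < \<theta>" "f \<theta> < f 0"
proof -
  obtain d where d: "0 < d" "\<And>h. 0 < h \<Longrightarrow> h < d \<Longrightarrow> f (0 + h) < f 0"
    using DERIV_neg_dec_right[OF assms] by blast
  show ?thesis using d(2)[of "d / 2"] d(1) by (intro that[of "d / 2"]) auto
qed

section \<open>Upper bound: covers by cylinders of typical words\<close>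

context piecewise_linear
begin

definition words :: "nat \<Rightarrow> nat list set" where
  "words m = {w. set w \<subseteq> {1..n} \<and> length w = m}"

lemma finite_words [simp]: "finite (words m)"
  unfolding words_def by (rule finite_lists_length_eq) simp

definition Z :: "real \<Rightarrow> real" where "Z t = (\<Sum>i\<in>{1..n}. exp (t * a i))"

lemma sum_words: "(\<Sum>w\<in>words m. exp (t * S w)) = Z t ^ m"
proof (induction m)
  case 0
  have "words 0 = {[]}" unfolding words_def by auto
  then show ?case by simp
next
  case (Suc m)
  have "words (Suc m) = (\<lambda>(i, w). i # w) ` ({1..n} \<times> words m)"
    unfolding words_def by (auto simp: length_Suc_conv image_iff)
  then have "(\<Sum>w\<in>words (Suc m). exp (t * S w)) = (\<Sum>(i, w)\<in>{1..n} \<times> words m. exp (t * S (i # w)))"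
    by (simp add: sum.reindex inj_on_def case_prod_beta)
  also have "\<dots> = (\<Sum>i\<in>{1..n}. \<Sum>w\<in>words m. exp (t * a i) * exp (t * S w))"
    by (simp add: sum.cartesian_product exp_add[symmetric] algebra_simps)
  also have "\<dots> = Z t * (\<Sum>w\<in>words m. exp (t * S w))"
    unfolding Z_def by (simp add: sum_product)
  finally show ?case using Suc by simp
qed

definition level :: "real \<Rightarrow> real set" where
  "level \<alpha> = {x \<in> repeller n X T. has_lyapunov_exponent n X T x \<alpha>}"

definition typical :: "real \<Rightarrow> real \<Rightarrow> nat \<Rightarrow> nat list set" where
  "typical \<alpha> \<epsilon> m = {w \<in> words m. \<bar>S w - real m * \<alpha>\<bar> \<le> real m * \<epsilon>}"

lemma finite_typical [simp]: "finite (typical \<alpha> \<epsilon> m)"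
  unfolding typical_def using finite_words[of m] by simp

lemma S_map: "S (map \<omega> [0..<m]) = (\<Sum>k<m. a (\<omega> k))"
  by (induction m) (simp_all add: S_def)

lemma eventually_typical:
  assumes \<omega>: "\<And>k. \<omega> k \<in> {1..n}" and lim: "(\<lambda>m. (\<Sum>k<m. a (\<omega> k)) / real m) \<longlonglongrightarrow> \<alpha>" and \<epsilon>: "0 < \<epsilon>"
  shows "eventually (\<lambda>m. map \<omega> [0..<m] \<in> typical \<alpha> \<epsilon> m) sequentially"
  using tendstoD[OF lim \<epsilon>] eventually_gt_at_top[of 0]
proof eventually_elim
  case (elim m)
  have "S (map \<omega> [0..<m]) - real m * \<alpha> = real m * ((\<Sum>k<m. a (\<omega> k)) / real m - \<alpha>)"
    using elim by (simp add: S_map field_simps)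
  then have "\<bar>S (map \<omega> [0..<m]) - real m * \<alpha>\<bar> = real m * \<bar>(\<Sum>k<m. a (\<omega> k)) / real m - \<alpha>\<bar>"
    by (simp add: abs_mult)
  also have "\<dots> \<le> real m * \<epsilon>" using elim by (intro mult_left_mono) (auto simp: dist_real_def)
  finally show ?case using \<omega> unfolding typical_def words_def by auto
qed

lemma gauge_cyl: "0 < s \<Longrightarrow> set w \<subseteq> {1..n} \<Longrightarrow> hausdorff_gauge s (cyl w) = exp (- s * S w)"
  using diameter_cyl[of w] cyl_nonempty[of w]
  by (simp add: hausdorff_gauge_def powr_def mult.commute)

text \<open>On typical words S w is m * \<alpha> up to m * \<epsilon>, so exp (- s * S w) may be
  traded for exp (t * S w) at the price of a fixed factor per letter. The latter sums to Z t ^ m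
  over all words, which leaves \<open>c ^ m\<close> with \<open>c < 1\<close>.\<close>

lemma hausdorff_null_typical:
  assumes s: "0 < s" and \<epsilon>: "ln (Z t) - (s + t) * \<alpha> + \<bar>s + t\<bar> * \<epsilon> < 0" and n: "0 < Z t"
    and A: "\<And>x m. x \<in> A \<Longrightarrow> N \<le> m \<Longrightarrow> \<exists>w\<in>typical \<alpha> \<epsilon> m. x \<in> cyl w"
  shows "hausdorff_measure s A = 0"
  unfolding hausdorff_measure_eq_0_iff
proof (intro allI impI)
  fix \<delta> :: real assume \<delta>: "0 < \<delta>"
  define c where "c = Z t * exp (- (s + t) * \<alpha> + \<bar>s + t\<bar> * \<epsilon>)"
  have "c = exp (ln (Z t) - (s + t) * \<alpha> + \<bar>s + t\<bar> * \<epsilon>)"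
    using n unfolding c_def by (simp add: exp_add exp_diff exp_minus field_simps)
  then have c: "0 \<le> c" "c < 1" using \<epsilon> by auto
  have sum: "(\<Sum>w\<in>typical \<alpha> \<epsilon> m. exp (- s * S w)) \<le> c ^ m" for m
  proof -
    have "exp (- s * S w) \<le> exp (t * S w) * exp (- (s + t) * \<alpha> + \<bar>s + t\<bar> * \<epsilon>) ^ m"
      if "w \<in> typical \<alpha> \<epsilon> m" for w
    proof -
      have "- (s + t) * (S w - real m * \<alpha>) \<le> \<bar>s + t\<bar> * \<bar>S w - real m * \<alpha>\<bar>"
        by (metis abs_ge_self abs_minus_cancel abs_mult)
      also have "\<dots> \<le> \<bar>s + t\<bar> * (real m * \<epsilon>)"
        using that unfolding typical_def by (intro mult_left_mono) auto
      finally have "- s * S w \<le> t * S w + real m * (- (s + t) * \<alpha> + \<bar>s + t\<bar> * \<epsilon>)"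
        by (simp add: algebra_simps)
      then show ?thesis by (simp add: exp_of_nat_mult[symmetric] exp_add[symmetric])
    qed
    then have "(\<Sum>w\<in>typical \<alpha> \<epsilon> m. exp (- s * S w))
        \<le> (\<Sum>w\<in>typical \<alpha> \<epsilon> m. exp (t * S w) * exp (- (s + t) * \<alpha> + \<bar>s + t\<bar> * \<epsilon>) ^ m)"
      by (rule sum_mono)
    also have "\<dots> \<le> (\<Sum>w\<in>words m. exp (t * S w) * exp (- (s + t) * \<alpha> + \<bar>s + t\<bar> * \<epsilon>) ^ m)"
      by (rule sum_mono2) (auto simp: typical_def)
    also have "\<dots> = c ^ m"
      unfolding c_def by (simp add: sum_distrib_right[symmetric] sum_words power_mult_distrib)
    finally show ?thesis .
  qed
  have bound: "hausdorff_premeasure s \<delta> A \<le> ennreal (c ^ m)" if m: "N \<le> m" "c ^ m \<le> \<delta> powr s" for m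
  proof -
    have W: "finite (typical \<alpha> \<epsilon> m)" "\<And>w. w \<in> typical \<alpha> \<epsilon> m \<Longrightarrow> set w \<subseteq> {1..n}"
      by (rule finite_typical) (auto simp: typical_def words_def)
    have "hausdorff_premeasure s \<delta> A \<le> (\<Sum>w\<in>typical \<alpha> \<epsilon> m. ennreal (hausdorff_gauge s (cyl w)))"
    proof (rule hausdorff_premeasure_finite_cover[OF W(1)])
      show "A \<subseteq> (\<Union>w\<in>typical \<alpha> \<epsilon> m. cyl w)" using A[OF _ m(1)] by blast
      fix w assume w: "w \<in> typical \<alpha> \<epsilon> m"
      show "bounded (cyl w)" using compact_cyl[OF W(2)[OF w]] compact_imp_bounded by blast
      \<comment> \<open>One gauge is at most the whole sum, so a small total cost already forces
        every cylinder to have diameter at most \<open>\<delta>\<close>.\<close>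
      have "exp (- s * S w) \<le> (\<Sum>w\<in>typical \<alpha> \<epsilon> m. exp (- s * S w))"
        using W(1) w by (intro member_le_sum) auto
      then have "exp (- S w) powr s \<le> \<delta> powr s" using sum[of m] m by (simp add: powr_def mult.commute)
      then show "diameter (cyl w) \<le> \<delta>"
        using powr_less_mono2[OF s, of \<delta> "exp (- S w)"] \<delta> diameter_cyl[OF W(2)[OF w]] by fastforce
    qed (use \<delta> in simp)
    also have "\<dots> = (\<Sum>w\<in>typical \<alpha> \<epsilon> m. ennreal (exp (- s * S w)))"
      using W(2) gauge_cyl[OF s] by (intro sum.cong) auto
    also have "\<dots> = ennreal (\<Sum>w\<in>typical \<alpha> \<epsilon> m. exp (- s * S w))" by (rule sum_ennreal) simp
    also have "\<dots> \<le> ennreal (c ^ m)" using sum by (intro ennreal_leI)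
    finally show ?thesis .
  qed
  have lim: "(\<lambda>m. c ^ m) \<longlonglongrightarrow> 0" using c by (intro LIMSEQ_realpow_zero) auto
  have "eventually (\<lambda>m. c ^ m < \<delta> powr s) sequentially"
    using order_tendstoD(2)[OF lim] \<delta> by simp
  then have ev: "eventually (\<lambda>m. hausdorff_premeasure s \<delta> A \<le> ennreal (c ^ m)) sequentially"
    using eventually_ge_at_top[of N] by eventually_elim (rule bound, auto)
  have "hausdorff_premeasure s \<delta> A \<le> ennreal 0"
    by (rule tendsto_lowerbound[OF tendsto_ennrealI[OF lim] ev]) simp
  then show "hausdorff_premeasure s \<delta> A = 0" by simp
qed

text \<open>Convergence gives typicality from some time on, but that time depends on the point.
  Splitting by it yields countably many sets \<open>A N\<close>, each null by the uniform
  estimate.\<close>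

lemma hausdorff_null_level:
  assumes s: "0 < s" "ln (Z t) < (s + t) * \<alpha>" and Z: "0 < Z t"
  shows "hausdorff_measure s (level \<alpha>) = 0"
proof -
  \<comment> \<open>The product of \<open>\<epsilon>\<close> and the denominator is the gap in the
    hypothesis; the extra 1 makes |s + t| * \<epsilon> strictly smaller than the gap.\<close>
  define \<epsilon> where "\<epsilon> = ((s + t) * \<alpha> - ln (Z t)) / (\<bar>s + t\<bar> + 1)"
  have \<epsilon>: "0 < \<epsilon>" unfolding \<epsilon>_def using s by (intro divide_pos_pos) auto
  have "\<epsilon> * (\<bar>s + t\<bar> + 1) = (s + t) * \<alpha> - ln (Z t)" unfolding \<epsilon>_def by simp
  then have small: "ln (Z t) - (s + t) * \<alpha> + \<bar>s + t\<bar> * \<epsilon> < 0"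
    using \<epsilon> by (simp add: algebra_simps)
  define A where "A N = {x. \<exists>\<omega>. itinerary x \<omega> \<and> (\<forall>m\<ge>N. map \<omega> [0..<m] \<in> typical \<alpha> \<epsilon> m)}" for N
  have "hausdorff_measure s (A N) = 0" for N
    by (rule hausdorff_null_typical[OF s(1) small Z, where N = N])
      (use itinerary_cyl in \<open>unfold A_def; blast\<close>)
  then have "hausdorff_measure s ((\<Union>k. E k) \<union> (\<Union>N. A N)) = 0"
    using hausdorff_null_countable[OF s(1) countable_E]
    by (intro hausdorff_null_Un hausdorff_null_UN)
  moreover have "level \<alpha> \<subseteq> (\<Union>k. E k) \<union> (\<Union>N. A N)"
  proof
    fix x assume x: "x \<in> level \<alpha>"
    show "x \<in> (\<Union>k. E k) \<union> (\<Union>N. A N)"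
    proof (cases "x \<in> (\<Union>k. E k)")
      case False
      then obtain \<omega> where \<omega>: "itinerary x \<omega>" using itinerary_exists x unfolding level_def by blast
      then have "eventually (\<lambda>m. map \<omega> [0..<m] \<in> typical \<alpha> \<epsilon> m) sequentially"
        using x exponent_iff[OF \<omega>] unfolding level_def
        by (intro eventually_typical \<epsilon>) (auto simp: itinerary_def)
      then show ?thesis using \<omega> unfolding A_def eventually_sequentially by blast
    qed simp
  qed
  ultimately show ?thesis using hausdorff_null_subset by blast
qed

section \<open>Large deviations for the tilted weights\<close>

lemma Z_deriv: "(Z has_real_derivative (\<Sum>i\<in>{1..n}. a i * exp (t * a i))) (at t)"
  unfolding Z_def by (auto intro!: derivative_eq_intros sum.cong)

lemma Z_pos: "1 \<le> n \<Longrightarrow> 0 < Z t"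
  unfolding Z_def by (intro sum_pos) auto

text \<open>Exponential Markov inequality, with \<open>\<sigma>\<close> selecting the tail. The rate
  \<open>f\<close> has f 0 = 1, and its derivative at 0 is - \<epsilon> because
  \<open>\<alpha>\<close> is the logarithmic derivative of \<open>Z\<close> at \<open>t\<close>; so
  some small \<open>\<theta>\<close> gives a rate below 1.\<close>

lemma chernoff:
  assumes n: "1 \<le> n" and \<epsilon>: "0 < \<epsilon>" and \<alpha>: "\<alpha> * Z t = (\<Sum>i\<in>{1..n}. a i * exp (t * a i))"
    and \<sigma>: "\<sigma> = 1 \<or> \<sigma> = - 1"
  obtains q where "0 < q" "q < 1"
    "\<And>m. (\<Sum>w\<in>{w\<in>words m. real m * \<epsilon> < \<sigma> * (S w - real m * \<alpha>)}. exp (t * S w) / Z t ^ m) \<le> q ^ m"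
proof -
  define f where "f \<theta> = Z (t + \<theta> * \<sigma>) / Z t * exp (- \<theta> * (\<sigma> * \<alpha> + \<epsilon>))" for \<theta>
  have Zt: "0 < Z t" using Z_pos[OF n] .
  have "((\<lambda>\<theta>. Z (t + \<theta> * \<sigma>)) has_real_derivative \<alpha> * Z t * \<sigma>) (at 0)"
    by (rule DERIV_chain2[where f = Z]) (use Z_deriv[of t] \<alpha> in \<open>auto intro!: derivative_eq_intros\<close>)
  then have "(f has_real_derivative - \<epsilon>) (at 0)"
    unfolding f_def using Zt \<sigma> by (auto intro!: derivative_eq_intros simp: field_simps)
  moreover have "f 0 = 1" unfolding f_def using Zt by simp
  ultimately obtain \<theta> where \<theta>: "0 < \<theta>" "f \<theta> < 1" using exists_DERIV_neg_less[of f "- \<epsilon>"] \<epsilon> by auto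
  have "(\<Sum>w\<in>{w\<in>words m. real m * \<epsilon> < \<sigma> * (S w - real m * \<alpha>)}. exp (t * S w) / Z t ^ m) \<le> f \<theta> ^ m" for m
  proof -
    let ?B = "{w\<in>words m. real m * \<epsilon> < \<sigma> * (S w - real m * \<alpha>)}"
    have "exp (t * S w) \<le> exp ((t + \<theta> * \<sigma>) * S w) * exp (- \<theta> * (\<sigma> * \<alpha> + \<epsilon>)) ^ m" if "w \<in> ?B" for w
    proof -
      have "\<theta> * (real m * \<epsilon>) \<le> \<theta> * (\<sigma> * (S w - real m * \<alpha>))" using that \<theta> by simp
      then have "t * S w \<le> (t + \<theta> * \<sigma>) * S w + real m * (- \<theta> * (\<sigma> * \<alpha> + \<epsilon>))"
        by (simp add: algebra_simps)
      then show ?thesis by (simp add: exp_of_nat_mult[symmetric] exp_add[symmetric])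
    qed
    then have "(\<Sum>w\<in>?B. exp (t * S w) / Z t ^ m)
        \<le> (\<Sum>w\<in>?B. exp ((t + \<theta> * \<sigma>) * S w) * exp (- \<theta> * (\<sigma> * \<alpha> + \<epsilon>)) ^ m / Z t ^ m)"
      using Zt by (intro sum_mono divide_right_mono) auto
    also have "\<dots> \<le> (\<Sum>w\<in>words m. exp ((t + \<theta> * \<sigma>) * S w) * exp (- \<theta> * (\<sigma> * \<alpha> + \<epsilon>)) ^ m / Z t ^ m)"
      using Zt by (intro sum_mono2) auto
    also have "\<dots> = f \<theta> ^ m"
      unfolding f_def
      by (simp add: sum_divide_distrib[symmetric] sum_distrib_right[symmetric] sum_words power_mult_distrib power_divide)
    finally show ?thesis .
  qed
  moreover have "0 < f \<theta>" unfolding f_def using Z_pos[OF n] by simp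
  ultimately show ?thesis using \<theta> that by blast
qed

lemma atypical_sum_le:
  assumes n: "1 \<le> n" and \<epsilon>: "0 < \<epsilon>" and \<alpha>: "\<alpha> * Z t = (\<Sum>i\<in>{1..n}. a i * exp (t * a i))"
  obtains q where "0 < q" "q < 1" "\<And>m. (\<Sum>w\<in>words m - typical \<alpha> \<epsilon> m. exp (t * S w) / Z t ^ m) \<le> 2 * q ^ m"
proof -
  obtain c1 where c1: "0 < c1" "c1 < 1"
    "\<And>m. (\<Sum>w\<in>{w\<in>words m. real m * \<epsilon> < 1 * (S w - real m * \<alpha>)}. exp (t * S w) / Z t ^ m) \<le> c1 ^ m"
    using chernoff[OF assms, of 1] by auto
  obtain c2 where c2: "0 < c2" "c2 < 1"
    "\<And>m. (\<Sum>w\<in>{w\<in>words m. real m * \<epsilon> < - 1 * (S w - real m * \<alpha>)}. exp (t * S w) / Z t ^ m) \<le> c2 ^ m"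
    using chernoff[OF assms, of "- 1"] by auto
  have "(\<Sum>w\<in>words m - typical \<alpha> \<epsilon> m. exp (t * S w) / Z t ^ m) \<le> 2 * max c1 c2 ^ m" for m
  proof -
    let ?B1 = "{w\<in>words m. real m * \<epsilon> < 1 * (S w - real m * \<alpha>)}"
    let ?B2 = "{w\<in>words m. real m * \<epsilon> < - 1 * (S w - real m * \<alpha>)}"
    have pos: "0 \<le> exp (t * S w) / Z t ^ m" for w using Z_pos[OF n, of t] by simp
    have "(\<Sum>w\<in>words m - typical \<alpha> \<epsilon> m. exp (t * S w) / Z t ^ m) \<le> (\<Sum>w\<in>?B1 \<union> ?B2. exp (t * S w) / Z t ^ m)"
      using pos by (intro sum_mono2) (auto simp: typical_def)
    also have "\<dots> \<le> (\<Sum>w\<in>?B1. exp (t * S w) / Z t ^ m) + (\<Sum>w\<in>?B2. exp (t * S w) / Z t ^ m)"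
      using sum.union_inter[of ?B1 ?B2 "\<lambda>w. exp (t * S w) / Z t ^ m"]
        sum_nonneg[of "?B1 \<inter> ?B2" "\<lambda>w. exp (t * S w) / Z t ^ m"] pos by simp
    also have "\<dots> \<le> c1 ^ m + c2 ^ m" using c1 c2 by (intro add_mono)
    also have "\<dots> \<le> max c1 c2 ^ m + max c1 c2 ^ m" using c1 c2 by (intro add_mono power_mono) auto
    finally show ?thesis by simp
  qed
  then show ?thesis using c1 c2 that[of "max c1 c2"] by auto
qed

end

section \<open>Lower bound: the Bernoulli measure on codes\<close>

locale gibbs = piecewise_linear +
  fixes t :: real and P :: "nat pmf"
  assumes n: "1 \<le> n" and pmf_P: "\<And>i. i \<in> {1..n} \<Longrightarrow> pmf P i = exp (t * a i) / Z t"
begin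

definition \<mu> :: "(nat \<Rightarrow> nat) measure" where "\<mu> = PiM UNIV (\<lambda>_. measure_pmf P)"

sublocale P: product_prob_space "\<lambda>_. measure_pmf P" UNIV
  by unfold_locales

sublocale \<mu>: prob_space \<mu>
  unfolding \<mu>_def by (rule P.prob_space_axioms)

lemma space_\<mu> [simp]: "space \<mu> = UNIV"
  unfolding \<mu>_def by (simp add: space_PiM)

definition coded :: "nat \<Rightarrow> nat list set \<Rightarrow> (nat \<Rightarrow> nat) set" where
  "coded m W = {\<omega>. map \<omega> [0..<m] \<in> W}"

lemma
  assumes "w \<in> words m"
  shows sets_coded_single: "coded m {w} \<in> sets \<mu>"
    and measure_coded_single: "measure \<mu> (coded m {w}) = exp (t * S w) / Z t ^ m"
proof -
  have eq: "coded m {w} = {\<omega> \<in> space \<mu>. \<forall>k\<in>{..<m}. \<omega> k \<in> {w ! k}}"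
    using assms unfolding coded_def words_def by (auto simp: list_eq_iff_nth_eq)
  have "{\<omega> \<in> space \<mu>. \<omega> k \<in> {w ! k}} \<in> sets \<mu>" for k
    unfolding \<mu>_def by (rule sets_Collect_single') auto
  then show "coded m {w} \<in> sets \<mu>"
    unfolding eq by (intro sets.sets_Collect_finite_All) auto
  have "emeasure \<mu> (coded m {w}) = (\<Prod>k\<in>{..<m}. emeasure (measure_pmf P) {w ! k})"
    unfolding eq unfolding \<mu>_def by (rule P.emeasure_PiM_Collect) auto
  also have "\<dots> = (\<Prod>k\<in>{..<m}. ennreal (exp (t * a (w ! k)) / Z t))"
  proof (rule prod.cong[OF refl])
    fix k assume "k \<in> {..<m}"
    then have "w ! k \<in> {1..n}" using assms nth_mem[of k w] unfolding words_def by blast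
    then show "emeasure (measure_pmf P) {w ! k} = ennreal (exp (t * a (w ! k)) / Z t)"
      by (simp only: emeasure_pmf_single pmf_P)
  qed
  also have "\<dots> = ennreal (\<Prod>k\<in>{..<m}. exp (t * a (w ! k)) / Z t)"
    using Z_pos[OF n, of t] by (intro prod_ennreal) auto
  also have "(\<Prod>k\<in>{..<m}. exp (t * a (w ! k)) / Z t) = exp (t * S w) / Z t ^ m"
  proof -
    have "S w = (\<Sum>k<m. a (w ! k))"
      using assms S_map[of "\<lambda>k. w ! k" m] map_nth[of w] unfolding words_def by simp
    then show ?thesis by (simp add: prod_dividef exp_sum sum_distrib_left)
  qed
  finally show "measure \<mu> (coded m {w}) = exp (t * S w) / Z t ^ m"
    using Z_pos[OF n, of t] by (simp add: measure_def)
qed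

lemma
  assumes "W \<subseteq> words m"
  shows sets_coded: "coded m W \<in> sets \<mu>"
    and measure_coded: "measure \<mu> (coded m W) = (\<Sum>w\<in>W. exp (t * S w) / Z t ^ m)"
proof -
  have fin: "finite W" using assms finite_words finite_subset by blast
  have eq: "coded m W = (\<Union>w\<in>W. coded m {w})" unfolding coded_def by auto
  show "coded m W \<in> sets \<mu>" unfolding eq using assms sets_coded_single fin by blast
  have "measure \<mu> (\<Union>w\<in>W. coded m {w}) = (\<Sum>w\<in>W. measure \<mu> (coded m {w}))"
    by (rule \<mu>.finite_measure_finite_Union[OF fin])
      (use assms sets_coded_single in \<open>auto simp: coded_def disjoint_family_on_def\<close>)
  then show "measure \<mu> (coded m W) = (\<Sum>w\<in>W. exp (t * S w) / Z t ^ m)"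
    unfolding eq using assms measure_coded_single by (auto intro!: sum.cong)
qed

text \<open>The atypical mass decays geometrically, hence is summable, and the Borel-Cantelli lemma
  applies.\<close>

lemma AE_eventually_typical:
  assumes \<epsilon>: "0 < \<epsilon>" and \<alpha>: "\<alpha> * Z t = (\<Sum>i\<in>{1..n}. a i * exp (t * a i))"
  shows "AE \<omega> in \<mu>. eventually (\<lambda>m. map \<omega> [0..<m] \<in> typical \<alpha> \<epsilon> m) sequentially"
proof -
  obtain c where c: "0 < c" "c < 1"
    "\<And>m. (\<Sum>w\<in>words m - typical \<alpha> \<epsilon> m. exp (t * S w) / Z t ^ m) \<le> 2 * c ^ m"
    using atypical_sum_le[OF n \<epsilon> \<alpha>] by blast
  have sub: "typical \<alpha> \<epsilon> m \<subseteq> words m" for m unfolding typical_def by auto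
  let ?A = "\<lambda>m. space \<mu> - coded m (typical \<alpha> \<epsilon> m)"
  have le: "measure \<mu> (?A m) \<le> 2 * c ^ m" for m
  proof -
    have "measure \<mu> (?A m) = 1 - (\<Sum>w\<in>typical \<alpha> \<epsilon> m. exp (t * S w) / Z t ^ m)"
      using \<mu>.prob_compl[OF sets_coded[OF sub]] measure_coded[OF sub] by simp
    also have "1 = (\<Sum>w\<in>words m. exp (t * S w) / Z t ^ m)"
      using Z_pos[OF n, of t] by (simp add: sum_divide_distrib[symmetric] sum_words)
    also have "(\<Sum>w\<in>words m. exp (t * S w) / Z t ^ m) - (\<Sum>w\<in>typical \<alpha> \<epsilon> m. exp (t * S w) / Z t ^ m)
        = (\<Sum>w\<in>words m - typical \<alpha> \<epsilon> m. exp (t * S w) / Z t ^ m)"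
      by (rule sum_diff[symmetric]) (use sub in auto)
    finally show ?thesis using c(3)[of m] by simp
  qed
  have "AE \<omega> in \<mu>. eventually (\<lambda>m. \<omega> \<in> space \<mu> - ?A m) sequentially"
  proof (rule borel_cantelli_AE1)
    show "?A m \<in> sets \<mu>" for m by (rule sets.compl_sets[OF sets_coded[OF sub]])
    show "emeasure \<mu> (?A m) < \<infinity>" for m by (simp add: less_top[symmetric])
    have "summable (\<lambda>m. 2 * c ^ m)" using c by (intro summable_mult summable_geometric) auto
    then show "summable (\<lambda>m. measure \<mu> (?A m))"
      by (rule summable_comparison_test_ev[rotated]) (use le in simp)
  qed
  then show ?thesis by (simp add: coded_def)
qed

lemma AE_lim:
  assumes \<alpha>: "\<alpha> * Z t = (\<Sum>i\<in>{1..n}. a i * exp (t * a i))"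
  shows "AE \<omega> in \<mu>. (\<forall>k. \<omega> k \<in> {1..n}) \<and> (\<lambda>m. (\<Sum>k<m. a (\<omega> k)) / real m) \<longlonglongrightarrow> \<alpha>"
proof -
  have "AE \<omega> in \<mu>. \<forall>j. eventually (\<lambda>m. map \<omega> [0..<m] \<in> typical \<alpha> (inverse (real (Suc j))) m) sequentially"
    unfolding AE_all_countable by (intro allI AE_eventually_typical \<alpha>) simp
  then show ?thesis
  proof eventually_elim
    case (elim \<omega>)
    show ?case
    proof
      \<comment> \<open>Typical words use only the letters 1 to \<open>n\<close>, so a long typical
        prefix also confines each single coordinate.\<close>
      show "\<forall>k. \<omega> k \<in> {1..n}"
      proof
        fix k
        obtain N where N: "\<And>m. N \<le> m \<Longrightarrow> map \<omega> [0..<m] \<in> typical \<alpha> (inverse (real (Suc 0))) m"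
          using elim[rule_format, of 0] unfolding eventually_sequentially by blast
        have "map \<omega> [0..<max N (Suc k)] \<in> words (max N (Suc k))"
          using N[of "max N (Suc k)"] unfolding typical_def by simp
        then show "\<omega> k \<in> {1..n}" unfolding words_def by (auto simp: subset_iff)
      qed
      show "(\<lambda>m. (\<Sum>k<m. a (\<omega> k)) / real m) \<longlonglongrightarrow> \<alpha>"
      proof (rule tendstoI)
        fix \<epsilon> :: real assume "0 < \<epsilon>"
        then obtain j where j: "inverse (real (Suc j)) < \<epsilon>" using reals_Archimedean by blast
        from elim[rule_format, of j] eventually_gt_at_top[of 0]
        show "eventually (\<lambda>m. dist ((\<Sum>k<m. a (\<omega> k)) / real m) \<alpha> < \<epsilon>) sequentially"
        proof eventually_elim
          case (elim m)
          have "\<bar>(\<Sum>k<m. a (\<omega> k)) - real m * \<alpha>\<bar> \<le> real m * inverse (real (Suc j))"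
            using elim(1) by (simp add: typical_def S_map)
          also have "\<dots> < real m * \<epsilon>" using elim j by (intro mult_strict_left_mono) auto
          finally have "\<bar>(\<Sum>k<m. a (\<omega> k)) - real m * \<alpha>\<bar> < real m * \<epsilon>" .
          moreover have "(\<Sum>k<m. a (\<omega> k)) / real m - \<alpha> = ((\<Sum>k<m. a (\<omega> k)) - real m * \<alpha>) / real m"
            using elim by (simp add: field_simps)
          ultimately show ?case using elim unfolding dist_real_def by (simp add: field_simps)
        qed
      qed
    qed
  qed
qed

text \<open>A single starting time \<open>N\<close> for all codes in the set, as in Egorov's
  theorem: mass estimates become uniform, while for some \<open>N\<close> the set still has positive
  measure.\<close>

definition good :: "real \<Rightarrow> real \<Rightarrow> nat \<Rightarrow> (nat \<Rightarrow> nat) set" where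
  "good \<alpha> \<epsilon> N = (\<Inter>m\<in>{N..}. coded m (typical \<alpha> \<epsilon> m))"

lemma sets_good: "good \<alpha> \<epsilon> N \<in> sets \<mu>"
  unfolding good_def using sets.top[of \<mu>] by (intro sets.countable_INT'' sets_coded) (auto simp: typical_def)

lemma good_positive:
  assumes \<epsilon>: "0 < \<epsilon>" and \<alpha>: "\<alpha> * Z t = (\<Sum>i\<in>{1..n}. a i * exp (t * a i))"
  obtains N where "0 < measure \<mu> (good \<alpha> \<epsilon> N)"
proof (rule ccontr)
  assume "\<not> thesis"
  then have "measure \<mu> (good \<alpha> \<epsilon> N) = 0" for N
    using that[of N] by (cases "measure \<mu> (good \<alpha> \<epsilon> N) = 0") (auto simp: zero_less_measure_iff)
  then have "good \<alpha> \<epsilon> N \<in> null_sets \<mu>" for N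
    using sets_good by (simp add: null_sets_def \<mu>.emeasure_eq_measure)
  then have "AE \<omega> in \<mu>. \<forall>N. \<omega> \<notin> good \<alpha> \<epsilon> N"
    unfolding AE_all_countable using AE_not_in by blast
  with AE_eventually_typical[OF assms] have "AE \<omega> in \<mu>. False"
  proof eventually_elim
    case (elim \<omega>)
    then show ?case unfolding good_def coded_def eventually_sequentially by auto
  qed
  then show False by simp
qed

text \<open>
  The event \<open>B\<close> consists of cylinders of a single length, chosen such that the cylinders of typical
  words are still at least \<open>\<rho>\<close> long; hence only boundedly many of them meet \<open>U\<close>. Working with \<open>B\<close>
  instead of the preimage of \<open>U\<close> under the coding map makes the measurability of that map irrelevant.
\<close>

lemma mass_bound:
  assumes s: "0 < s" and \<alpha>: "0 < \<alpha> + \<epsilon>" and se: "s * (\<alpha> + \<epsilon>) \<le> ln (Z t) - t * \<alpha> - \<bar>t\<bar> * \<epsilon>"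
    and \<rho>: "0 < \<rho>" "\<rho> \<le> exp (- (real N * (\<alpha> + \<epsilon>)))"
    and U: "\<And>x y. x \<in> U \<Longrightarrow> y \<in> U \<Longrightarrow> \<bar>x - y\<bar> \<le> \<rho>"
  obtains B where "B \<in> sets \<mu>" "measure \<mu> B \<le> 11 * exp (s * (\<alpha> + \<epsilon>)) * \<rho> powr s"
    "\<And>\<omega> x. \<omega> \<in> good \<alpha> \<epsilon> N \<Longrightarrow> x \<in> U \<Longrightarrow> (\<And>m. x \<in> cyl (map \<omega> [0..<m])) \<Longrightarrow> \<omega> \<in> B"
proof -
  \<comment> \<open>The largest \<open>m\<close> with exp (- m * (\<alpha> + \<epsilon>)) at least
    \<open>\<rho>\<close>. The bound on \<open>\<rho>\<close> makes it at least \<open>N\<close>, so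
    membership in \<open>good\<close> applies to words of this length.\<close>
  define m where "m = nat \<lfloor>- ln \<rho> / (\<alpha> + \<epsilon>)\<rfloor>"
  have "ln \<rho> \<le> - (real N * (\<alpha> + \<epsilon>))" 
    using \<rho> ln_le_cancel_iff[of \<rho> "exp (- (real N * (\<alpha> + \<epsilon>)))"] by simp
  then have N: "real N \<le> - ln \<rho> / (\<alpha> + \<epsilon>)" using \<alpha> by (simp add: field_simps)
  then have m: "N \<le> m" "real m \<le> - ln \<rho> / (\<alpha> + \<epsilon>)" "- ln \<rho> / (\<alpha> + \<epsilon>) < real m + 1"
    unfolding m_def by linarith+
  then have m': "real m * (\<alpha> + \<epsilon>) \<le> - ln \<rho>" "- ln \<rho> < (real m + 1) * (\<alpha> + \<epsilon>)"
    using \<alpha> by (simp_all add: field_simps)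
  define W where "W = {w \<in> typical \<alpha> \<epsilon> m. cyl w \<inter> U \<noteq> {}}"
  have W: "W \<subseteq> words m" unfolding W_def typical_def by auto
  have card: "finite W \<and> card W \<le> 11"
  proof (rule card_intervals_meeting_le[of \<rho> W cyl U])
    fix w assume w: "w \<in> W"
    then have "S w \<le> real m * (\<alpha> + \<epsilon>)" unfolding W_def typical_def by (auto simp: algebra_simps)
    then have "\<rho> \<le> exp (- S w)" using m'(1) \<rho>(1) by (metis exp_le_cancel_iff exp_ln le_minus_iff order_trans)
    moreover have "cyl w \<inter> U \<noteq> {}" "set w \<subseteq> {1..n}" using w W unfolding W_def words_def by auto
    ultimately show "\<exists>l u. cyl w = {l..u} \<and> \<rho> \<le> u - l \<and> cyl w \<inter> U \<noteq> {}"
      using cyl_interval[of w] by metis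
  next
    fix v w x y
    assume "v \<in> W" "w \<in> W" "x < y" "{x<..<y} \<subseteq> cyl v" "{x<..<y} \<subseteq> cyl w"
    then show "v = w" using W unfolding words_def by (intro cyl_nonoverlap[of v w x y]) auto
  qed (use \<rho> U in auto)
  have mass_le: "exp (t * S w) / Z t ^ m \<le> exp (s * (\<alpha> + \<epsilon>)) * \<rho> powr s" if w: "w \<in> W" for w
  proof -
    have "t * (S w - real m * \<alpha>) \<le> \<bar>t\<bar> * \<bar>S w - real m * \<alpha>\<bar>" by (metis abs_ge_self abs_mult)
    also have "\<dots> \<le> \<bar>t\<bar> * (real m * \<epsilon>)"
      using w unfolding W_def typical_def by (intro mult_left_mono) auto
    finally have "t * S w - real m * ln (Z t) \<le> - real m * (ln (Z t) - t * \<alpha> - \<bar>t\<bar> * \<epsilon>)"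
      by (simp add: algebra_simps)
    also have "\<dots> \<le> - real m * (s * (\<alpha> + \<epsilon>))" using se by (intro mult_left_mono_neg) auto
    \<comment> \<open>Maximality of \<open>m\<close>: rounding down loses less than one letter,
      which costs the factor exp (s * (\<alpha> + \<epsilon>)).\<close>
    also have "\<dots> \<le> s * (\<alpha> + \<epsilon>) + s * ln \<rho>"
    proof -
      have "s * (- ln \<rho>) \<le> s * ((real m + 1) * (\<alpha> + \<epsilon>))" using m'(2) s by (intro mult_left_mono) auto
      then show ?thesis by (simp add: algebra_simps)
    qed
    finally have "exp (t * S w - real m * ln (Z t)) \<le> exp (s * (\<alpha> + \<epsilon>) + s * ln \<rho>)" by simp
    then show ?thesis
      using Z_pos[OF n, of t] \<rho> by (simp add: exp_diff exp_add exp_of_nat_mult powr_def)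
  qed
  have "(\<Sum>w\<in>W. exp (t * S w) / Z t ^ m) \<le> real (card W) * (exp (s * (\<alpha> + \<epsilon>)) * \<rho> powr s)"
    by (rule sum_bounded_above) (rule mass_le)
  also have "\<dots> \<le> 11 * (exp (s * (\<alpha> + \<epsilon>)) * \<rho> powr s)" 
    by (rule mult_right_mono) (use conjunct2[OF card] in simp_all)
  finally have "measure \<mu> (coded m W) \<le> 11 * exp (s * (\<alpha> + \<epsilon>)) * \<rho> powr s"
    unfolding measure_coded[OF W] by simp
  then show ?thesis
  proof (rule that[OF sets_coded[OF W]])
    fix \<omega> x assume "\<omega> \<in> good \<alpha> \<epsilon> N" "x \<in> U" "\<And>m. x \<in> cyl (map \<omega> [0..<m])"
    then show "\<omega> \<in> coded m W" using m(1) unfolding good_def coded_def W_def by auto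
  qed
qed

text \<open>Mass distribution principle: a cover of small total gauge would produce events of small
  total measure that cover almost all of a \<open>good\<close> set of positive measure.\<close>

lemma level_not_null:
  assumes \<alpha>: "\<alpha> * Z t = (\<Sum>i\<in>{1..n}. a i * exp (t * a i))"
    and s: "0 < s" "s * \<alpha> < ln (Z t) - t * \<alpha>" and "0 < \<alpha>"
  shows "hausdorff_measure s (level \<alpha>) \<noteq> 0"
proof
  assume null: "hausdorff_measure s (level \<alpha>) = 0"
  \<comment> \<open>Chosen so that the hypothesis of \<open>mass_bound\<close> relating
    \<open>s\<close>, \<open>\<alpha>\<close> and \<open>\<epsilon>\<close> holds with
    equality.\<close>
  define \<epsilon> where "\<epsilon> = (ln (Z t) - t * \<alpha> - s * \<alpha>) / (s + \<bar>t\<bar>)"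
  have \<epsilon>: "0 < \<epsilon>" unfolding \<epsilon>_def using s by (intro divide_pos_pos) auto
  have "\<epsilon> * (s + \<bar>t\<bar>) = ln (Z t) - t * \<alpha> - s * \<alpha>" unfolding \<epsilon>_def using s by simp
  then have se: "s * (\<alpha> + \<epsilon>) \<le> ln (Z t) - t * \<alpha> - \<bar>t\<bar> * \<epsilon>" by (simp add: algebra_simps)
  have \<alpha>\<epsilon>: "0 < \<alpha> + \<epsilon>" using \<epsilon> assms by simp
  obtain N where N: "0 < measure \<mu> (good \<alpha> \<epsilon> N)" using good_positive[OF \<epsilon> \<alpha>] .
  define K where "K = 11 * exp (s * (\<alpha> + \<epsilon>))"
  define r where "r = exp (- (real N * (\<alpha> + \<epsilon>)))"
  have K: "0 < K" and r: "0 < r" unfolding K_def r_def by auto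
  \<comment> \<open>The first bound makes every \<open>\<rho> j\<close> at most \<open>r\<close>, as
    \<open>mass_bound\<close> requires; the second makes the final total 2 * K * \<eta> at most two
    thirds of the measure of \<open>good\<close>.\<close>
  define \<eta> where "\<eta> = min (r powr s / 2) (measure \<mu> (good \<alpha> \<epsilon> N) / (3 * K))"
  have \<eta>: "0 < \<eta>" "2 * \<eta> \<le> r powr s" "2 * K * \<eta> < measure \<mu> (good \<alpha> \<epsilon> N)"
  proof -
    show "0 < \<eta>" "2 * \<eta> \<le> r powr s" unfolding \<eta>_def using N K r by auto
    have "\<eta> \<le> measure \<mu> (good \<alpha> \<epsilon> N) / (3 * K)" unfolding \<eta>_def by simp
    then have "3 * (K * \<eta>) \<le> measure \<mu> (good \<alpha> \<epsilon> N)" using K by (simp add: field_simps)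
    moreover have "0 < K * \<eta>" using K \<open>0 < \<eta>\<close> by simp
    ultimately show "2 * K * \<eta> < measure \<mu> (good \<alpha> \<epsilon> N)" by linarith
  qed
  \<comment> \<open>A coded point may fall into \<open>E\<close>, where its exponent is not under
    control, so \<open>E\<close> is covered as well. Scale 1 suffices below: a gauge less than
    \<open>\<eta>\<close> already forces a small diameter.\<close>
  have "hausdorff_measure s (level \<alpha> \<union> (\<Union>k. E k)) = 0"
    by (rule hausdorff_null_Un[OF null hausdorff_null_UN[OF hausdorff_null_countable[OF s(1) countable_E]]])
  then have "hausdorff_premeasure s 1 (level \<alpha> \<union> (\<Union>k. E k)) < ennreal \<eta>"
    using \<eta>(1) unfolding hausdorff_measure_eq_0_iff by simp
  then obtain U where U: "level \<alpha> \<union> (\<Union>k. E k) \<subseteq> (\<Union>j::nat. U j)" "\<And>j. bounded (U j)"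
    "(\<Sum>j. ennreal (hausdorff_gauge s (U j))) < ennreal \<eta>"
    by (rule hausdorff_premeasure_less) auto
  have gauge: "0 \<le> hausdorff_gauge s (U j)" for j unfolding hausdorff_gauge_def by simp
  have gauge_le: "hausdorff_gauge s (U j) < \<eta>" for j
  proof -
    have "ennreal (hausdorff_gauge s (U j)) = (\<Sum>j\<in>{j}. ennreal (hausdorff_gauge s (U j)))" by simp
    also have "\<dots> \<le> (\<Sum>j. ennreal (hausdorff_gauge s (U j)))" by (rule sum_le_suminf) auto
    finally have "ennreal (hausdorff_gauge s (U j)) < ennreal \<eta>" using U(3) by (rule le_less_trans)
    then show ?thesis using gauge by (simp add: ennreal_less_iff)
  qed
  \<comment> \<open>The summand \<open>\<eta> * (1/2)^Suc j\<close> keeps \<open>\<rho> j\<close> positive when \<open>U j\<close> is a single point.\<close>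
  define \<rho> where "\<rho> j = (hausdorff_gauge s (U j) + \<eta> * (1/2)^Suc j) powr (1 / s)" for j
  have base: "0 < hausdorff_gauge s (U j) + \<eta> * (1/2)^Suc j" for j using gauge \<eta>(1) by (simp add: add_nonneg_pos)
  have \<rho>_powr: "\<rho> j powr s = hausdorff_gauge s (U j) + \<eta> * (1/2)^Suc j" for j
    unfolding \<rho>_def powr_powr using s base[of j] by simp
  have \<rho>_pos: "0 < \<rho> j" for j unfolding \<rho>_def using base[of j] by simp
  have \<rho>_le: "\<rho> j \<le> r" for j
  proof -
    have "\<eta> * (1/2)^Suc j \<le> \<eta> * 1" using \<eta>(1) by (intro mult_left_mono power_le_one) auto
    then have "\<rho> j powr s \<le> r powr s" using gauge_le[of j] \<eta>(2) \<rho>_powr[of j] by linarith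
    then show ?thesis using powr_less_mono2[OF s(1), of r "\<rho> j"] r by fastforce
  qed
  have diam: "\<bar>x - y\<bar> \<le> \<rho> j" if "x \<in> U j" "y \<in> U j" for x y j
  proof -
    have "dist x y \<le> diameter (U j)" using diameter_bounded_bound[OF U(2) that] .
    moreover have "diameter (U j) \<le> \<rho> j"
    proof (rule ccontr)
      assume "\<not> ?thesis"
      then have "\<rho> j powr s < diameter (U j) powr s"
        using powr_less_mono2[OF s(1)] \<rho>_pos[of j] by simp
      moreover have "diameter (U j) powr s = hausdorff_gauge s (U j)"
        using that s(1) unfolding hausdorff_gauge_def by auto
      moreover have "hausdorff_gauge s (U j) < \<rho> j powr s" unfolding \<rho>_powr using \<eta>(1) by simp
      ultimately show False by linarith
    qed
    ultimately show ?thesis by (simp add: dist_real_def)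
  qed
  have "\<exists>B. B \<in> sets \<mu> \<and> measure \<mu> B \<le> K * \<rho> j powr s \<and>
    (\<forall>\<omega> x. \<omega> \<in> good \<alpha> \<epsilon> N \<longrightarrow> x \<in> U j \<longrightarrow> (\<forall>m. x \<in> cyl (map \<omega> [0..<m])) \<longrightarrow> \<omega> \<in> B)" for j
    by (rule mass_bound[where U = "U j" and \<rho> = "\<rho> j", OF s(1) \<alpha>\<epsilon> se \<rho>_pos \<rho>_le[unfolded r_def] diam])
      (unfold K_def, blast+)
  then obtain B where B: "\<And>j. B j \<in> sets \<mu>" "\<And>j. measure \<mu> (B j) \<le> K * \<rho> j powr s"
    "\<And>j \<omega> x. \<omega> \<in> good \<alpha> \<epsilon> N \<Longrightarrow> x \<in> U j \<Longrightarrow> (\<And>m. x \<in> cyl (map \<omega> [0..<m])) \<Longrightarrow> \<omega> \<in> B j"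
    by metis
  have "AE \<omega> in \<mu>. \<omega> \<in> good \<alpha> \<epsilon> N \<longrightarrow> \<omega> \<in> (\<Union>j. B j)"
    using AE_lim[OF \<alpha>]
  proof eventually_elim
    case (elim \<omega>)
    show ?case
    proof
      assume good: "\<omega> \<in> good \<alpha> \<epsilon> N"
      obtain x where x: "\<And>m. x \<in> cyl (map \<omega> [0..<m])" using coded_point_exists elim by blast
      have "x \<in> level \<alpha> \<union> (\<Union>k. E k)"
        using coded_point_itinerary[of \<omega> x] x elim exponent_iff[of x \<omega> \<alpha>] unfolding level_def by blast
      then obtain j where "x \<in> U j" using U(1) by blast
      then show "\<omega> \<in> (\<Union>j. B j)" using B(3)[OF good _ x] by blast
    qed
  qed
  then have "emeasure \<mu> (good \<alpha> \<epsilon> N) \<le> emeasure \<mu> (\<Union>j. B j)"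
    using B(1) by (intro emeasure_mono_AE) auto
  also have "\<dots> \<le> (\<Sum>j. emeasure \<mu> (B j))" using B(1) by (intro emeasure_subadditive_countably) auto
  also have "\<dots> \<le> (\<Sum>j. ennreal K * (ennreal (hausdorff_gauge s (U j)) + ennreal (\<eta> * (1/2)^Suc j)))"
  proof (rule suminf_le)
    fix j
    have "emeasure \<mu> (B j) \<le> ennreal (K * (hausdorff_gauge s (U j) + \<eta> * (1/2)^Suc j))"
      unfolding \<mu>.emeasure_eq_measure using B(2)[of j] \<rho>_powr[of j] by (intro ennreal_leI) simp
    also have "\<dots> = ennreal K * (ennreal (hausdorff_gauge s (U j)) + ennreal (\<eta> * (1/2)^Suc j))"
      using K gauge \<eta>(1) by (simp add: ennreal_mult ennreal_plus del: power_Suc)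
    finally show "emeasure \<mu> (B j) \<le> ennreal K * (ennreal (hausdorff_gauge s (U j)) + ennreal (\<eta> * (1/2)^Suc j))" .
  qed auto
  also have "\<dots> = ennreal K * ((\<Sum>j. ennreal (hausdorff_gauge s (U j))) + ennreal \<eta>)"
    unfolding ennreal_suminf_cmult suminf_add[OF summableI summableI, symmetric]
      suminf_ennreal_geometric[OF less_imp_le[OF \<eta>(1)]] ..
  also have "\<dots> \<le> ennreal K * (ennreal \<eta> + ennreal \<eta>)" using U(3) by (intro mult_left_mono add_right_mono) auto
  also have "\<dots> = ennreal (2 * K * \<eta>)"
    using ennreal_plus[of \<eta> \<eta>] ennreal_mult[of K "\<eta> + \<eta>"] K \<eta>(1) by (simp add: mult.assoc mult.left_commute)
  finally have "measure \<mu> (good \<alpha> \<epsilon> N) \<le> 2 * K * \<eta>"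
    unfolding \<mu>.emeasure_eq_measure using K \<eta>(1) by (simp add: ennreal_le_iff)
  then show False using \<eta>(3) by simp
qed

end

section \<open>The dimension formula and its application to three branches\<close>

lemma (in piecewise_linear) gibbs_pmf_exists:
  assumes n: "1 \<le> n"
  obtains P where "gibbs n X T g a c d lo hi t P"
proof -
  define f where "f i = (if i \<in> {1..n} then exp (t * a i) / Z t else 0)" for i
  have f: "0 \<le> f i" for i using Z_pos[OF n, of t] unfolding f_def by simp
  have "(\<integral>\<^sup>+ i. ennreal (f i) \<partial>count_space UNIV) = (\<Sum>i\<in>{1..n}. ennreal (f i))"
    by (rule nn_integral_count_space') (auto simp: f_def)
  also have "\<dots> = ennreal (\<Sum>i\<in>{1..n}. f i)" using f by (rule sum_ennreal)
  also have "(\<Sum>i\<in>{1..n}. f i) = (\<Sum>i\<in>{1..n}. exp (t * a i)) / Z t"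
    unfolding sum_divide_distrib by (rule sum.cong) (auto simp: f_def)
  also have "\<dots> = 1" using Z_pos[OF n, of t] unfolding Z_def by simp
  finally have "pmf (embed_pmf f) i = f i" for i using f by (intro pmf_embed_pmf) auto
  then have "gibbs n X T g a c d lo hi t (embed_pmf f)"
    by unfold_locales (use n in \<open>auto simp: f_def\<close>)
  then show ?thesis by (rule that)
qed

lemma (in piecewise_linear) spectrum_eq:
  assumes n: "1 \<le> n" and \<alpha>: "\<alpha> * Z t = (\<Sum>i\<in>{1..n}. a i * exp (t * a i))"
  shows "lyapunov_spectrum n X T \<alpha> = ln (Z t) / \<alpha> - t"
proof -
  have Z: "0 < Z t" using Z_pos[OF n] .
  have "0 < (\<Sum>i\<in>{1..n}. a i * exp (t * a i))" using n a_pos by (intro sum_pos) auto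
  then have \<alpha>_pos: "0 < \<alpha>" using \<alpha> Z by (metis zero_less_mult_pos2)
  define D where "D = ln (Z t) / \<alpha> - t"
  \<comment> \<open>ln (Z t) - t * \<alpha> is the Shannon entropy of the weights, the average of
    the nonnegative numbers ln (Z t) - t * a i. Without the sign, \<open>ennreal D\<close> would not
    determine \<open>D\<close>.\<close>
  have "0 \<le> D"
  proof -
    have "t * a i \<le> ln (Z t)" if "i \<in> {1..n}" for i
    proof -
      have "exp (t * a i) \<le> Z t" unfolding Z_def using that by (intro member_le_sum) auto
      then show ?thesis using Z by (simp add: ln_ge_iff)
    qed
    then have "0 \<le> (\<Sum>i\<in>{1..n}. (ln (Z t) - t * a i) * exp (t * a i))" by (intro sum_nonneg) simp
    also have "\<dots> = ln (Z t) * Z t - t * (\<Sum>i\<in>{1..n}. a i * exp (t * a i))"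
      unfolding Z_def by (simp add: left_diff_distrib sum_subtractf sum_distrib_left mult.assoc)
    also have "\<dots> = (ln (Z t) - t * \<alpha>) * Z t" unfolding \<alpha>[symmetric] by (simp add: algebra_simps)
    finally have "0 \<le> ln (Z t) - t * \<alpha>" using Z by (simp add: zero_le_mult_iff)
    then show ?thesis unfolding D_def using \<alpha>_pos by (simp add: field_simps)
  qed
  have null: "hausdorff_measure s (level \<alpha>) = 0" if "D < s" for s
  proof (rule hausdorff_null_level[OF _ _ Z])
    show "0 < s" using that \<open>0 \<le> D\<close> by simp
    have "ln (Z t) / \<alpha> < s + t" using that unfolding D_def by simp
    then show "ln (Z t) < (s + t) * \<alpha>" using \<alpha>_pos by (simp add: field_simps)
  qed
  have not_null: "hausdorff_measure s (level \<alpha>) \<noteq> 0" if s: "0 < s" "s < D" for s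
  proof -
    obtain P where "gibbs n X T g a c d lo hi t P" using gibbs_pmf_exists[OF n] .
    then interpret gibbs n X T g a c d lo hi t P .
    show ?thesis
    proof (rule level_not_null[OF \<alpha> s(1) _ \<alpha>_pos])
      show "s * \<alpha> < ln (Z t) - t * \<alpha>" using s(2) \<alpha>_pos unfolding D_def by (simp add: field_simps)
    qed
  qed
  have "hausdorff_dim (level \<alpha>) = ennreal D"
  proof (rule antisym)
    show "hausdorff_dim (level \<alpha>) \<le> ennreal D"
    proof (rule ennreal_le_epsilon)
      fix e :: real assume "0 < e"
      then have "hausdorff_dim (level \<alpha>) \<le> ennreal (D + e)"
        unfolding hausdorff_dim_def using null[of "D + e"] \<open>0 \<le> D\<close> by (intro INF_lower) auto
      then show "hausdorff_dim (level \<alpha>) \<le> ennreal D + ennreal e"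
        using \<open>0 < e\<close> \<open>0 \<le> D\<close> by (simp add: ennreal_plus)
    qed
    show "ennreal D \<le> hausdorff_dim (level \<alpha>)"
      unfolding hausdorff_dim_def
    proof (rule INF_greatest)
      fix s :: real assume s: "s \<in> {s. 0 \<le> s \<and> hausdorff_measure s (level \<alpha>) = 0}"
      have "D \<le> s"
      proof (rule ccontr)
        assume "\<not> D \<le> s"
        \<comment> \<open>Only exponent 0 remains. Nullity there makes the level set empty, hence
          null at \<open>D / 2\<close> too, against \<open>not_null\<close>.\<close>
        moreover have "s = 0" using s not_null[of s] \<open>\<not> D \<le> s\<close> by fastforce
        moreover have "level \<alpha> = {}" using hausdorff_measure_0_null[of "level \<alpha>"] s \<open>s = 0\<close> by simp
        ultimately show False
          using not_null[of "D / 2"] hausdorff_null_countable[of "D / 2" "level \<alpha>"] by simp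
      qed
      then show "ennreal D \<le> ennreal s" by (rule ennreal_leI)
    qed
  qed
  then show ?thesis
    unfolding lyapunov_spectrum_def level_def D_def[symmetric] using \<open>0 \<le> D\<close> by simp
qed

lemma bchoice2:
  assumes "\<And>i. i \<in> A \<Longrightarrow> \<exists>x y. Q i x y"
  obtains f g where "\<And>i. i \<in> A \<Longrightarrow> Q i (f i) (g i)"
  using assms by metis

lemma pl_expanding_map_piecewise_linear:
  assumes "pl_expanding_map n X T"
  obtains g c d lo hi where "piecewise_linear n X T g (\<lambda>i. ln (slope X i)) c d lo hi"
proof -
  from assms obtain g where
    branches: "\<forall>i\<in>{1..n}. (\<exists>a b. X i = {a..b}) \<and> X i \<subseteq> {0..1} \<and> 1 < slope X i"
    and disj: "disjoint_family_on (\<lambda>i. interior (X i)) {1..n}"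
    and maps: "\<forall>i\<in>{1..n}. (\<exists>c d. \<forall>x. g i x = c * x + d) \<and> g i ` X i = {0..1}"
    and T': "\<forall>x\<in>branch_union n X. \<exists>i\<in>{1..n}. x \<in> X i \<and> T x = g i x"
    unfolding pl_expanding_map_def by (elim conjE exE) (rule that)
  have Xi: "\<exists>a b. X i = {a..b}" and sub: "X i \<subseteq> {0..1}" and sl: "1 < slope X i" if "i \<in> {1..n}" for i
    using bspec[OF branches that] by blast+
  have aff: "\<exists>c d. \<forall>x. g i x = c * x + d" and onto: "g i ` X i = {0..1}" if "i \<in> {1..n}" for i
    using bspec[OF maps that] by blast+
  have T: "\<exists>i\<in>{1..n}. x \<in> X i \<and> T x = g i x" if "x \<in> branch_union n X" for x
    using bspec[OF T' that] .
  obtain lo hi where X: "\<And>i. i \<in> {1..n} \<Longrightarrow> X i = {lo i..hi i}"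
    by (rule bchoice2[where A = "{1..n}" and Q = "\<lambda>i a b. X i = {a..b}"], erule Xi, rule that)
  obtain c d where g': "\<And>i. i \<in> {1..n} \<Longrightarrow> \<forall>x. g i x = c i * x + d i"
    by (rule bchoice2[where A = "{1..n}" and Q = "\<lambda>i c d. \<forall>x. g i x = c * x + d"], erule aff, rule that)
  have g: "g i x = c i * x + d i" if "i \<in> {1..n}" for i x
    by (rule spec[OF g'[OF that]])
  have lt: "lo i < hi i" if "i \<in> {1..n}" for i
  proof (rule ccontr)
    \<comment> \<open>A degenerate interval has measure 0, and as inverse 0 = 0 its
      \<open>slope\<close> would be 0.\<close>
    assume "\<not> lo i < hi i"
    then have "measure lborel (X i) = 0" unfolding X[OF that] by (cases "lo i = hi i") auto
    then show False using sl[OF that] unfolding slope_def by simp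
  qed
  have "\<bar>c i\<bar> = slope X i" if i: "i \<in> {1..n}" for i
  proof -
    have slope: "slope X i = 1 / (hi i - lo i)"
      unfolding slope_def X[OF i] using lt[OF i] by (simp add: field_simps)
    have "(\<lambda>x. c i * x + d i) ` {lo i..hi i} = {0..1}"
      using onto[OF i] g[OF i] X[OF i] by simp
    then have "(if 0 \<le> c i then {c i * lo i + d i..c i * hi i + d i}
        else {c i * hi i + d i..c i * lo i + d i}) = {0..1}"
      using lt[OF i] by (simp add: image_affinity_atLeastAtMost)
    then have "\<bar>c i\<bar> * (hi i - lo i) = 1"
      by (auto simp: Icc_eq_Icc algebra_simps split: if_splits)
    then show ?thesis unfolding slope using lt[OF i] by (simp add: field_simps)
  qed
  then have "\<bar>c i\<bar> = exp (ln (slope X i))" if "i \<in> {1..n}" for i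
    using sl[OF that] that by simp
  then have "piecewise_linear n X T g (\<lambda>i. ln (slope X i)) c d lo hi"
    by unfold_locales (use X lt sub disj g onto sl T in \<open>simp_all only: ln_gt_zero\<close>)
  then show ?thesis by (rule that)
qed

theorem theorem2p2:
  fixes X :: "nat \<Rightarrow> real set" and T :: "real \<Rightarrow> real"
  assumes "pl_expanding_map 3 X T"
  shows "finite (lyapunov_inflections 3 X T) \<and> card (lyapunov_inflections 3 X T) \<le> 2"
proof -
  define a where "a i = ln (slope X i)" for i
  obtain g c d lo hi where "piecewise_linear 3 X T g (\<lambda>i. ln (slope X i)) c d lo hi"
    using pl_expanding_map_piecewise_linear[OF assms] .
  then interpret piecewise_linear 3 X T g a c d lo hi unfolding a_def[abs_def] .
  have slope: "1 < slope X i" if "i \<in> {1..3}" for i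
    using assms that unfolding pl_expanding_map_def by blast
  have mono: "mono_on {1..3} (slope X)" using assms unfolding pl_expanding_map_def by blast
  have a_mono: "a i \<le> a j" if "i \<in> {1..3}" "j \<in> {1..3}" "i \<le> j" for i j
    unfolding a_def using mono_onD[OF mono that] slope[OF that(1)] by simp
  have I: "lyapunov_inflections 3 X T = {\<alpha> \<in> {a 1<..<a 3}. deriv (deriv (lyapunov_spectrum 3 X T)) \<alpha> = 0}"
    unfolding lyapunov_inflections_def a_def by simp
  show ?thesis
  proof (cases "a 1 < a 3")
    \<comment> \<open>All slopes coincide, so the open interval of exponents is empty.\<close>
    case False
    then show ?thesis unfolding I by simp
  next
    case True
    interpret E: three_exponents "a 1" "a 2" "a 3"
      by unfold_locales (use a_mono[of 1 2] a_mono[of 2 3] a_pos[of 1] True in simp_all)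
    have set: "{1..3::nat} = {1, 2, 3}" by auto
    have Z: "Z t = E.F 0 t" for t
      unfolding Z_def set E.F_def by (simp add: mult.commute)
    have S1: "(\<Sum>i\<in>{1..3}. a i * exp (t * a i)) = E.F 1 t" for t
      unfolding set E.F_def by (simp add: mult.commute)
    have "lyapunov_spectrum 3 X T (E.mean t) = ln (E.F 0 t) / E.mean t - t" for t
    proof -
      have "E.mean t * Z t = (\<Sum>i\<in>{1..3}. a i * exp (t * a i))"
        unfolding S1 Z E.mean_def using E.F_pos[of 0 t] by simp
      then show ?thesis using spectrum_eq[of "E.mean t" t] unfolding Z by simp
    qed
    then show ?thesis unfolding I by (rule E.inflections_le_2)
  qed
qed

end
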